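(* Let $X,Y$ be Hilbert spaces, $A:X\to Y$ a bounded linear operator with $\|A^*A\|\le1$, let $\beta>-1$, and suppose that the source condition $x^\dagger=(A^*A)^\mu\omega$ holds with some $\mu>0$ and some $\omega\in X$. For noisy data $y^\delta\in Y$ with $\|Ax^\dagger-y^\delta\|=\delta$, let $x_k^\delta$ be the iterates of the Nesterov iteration with $\alpha_k=\frac{k-1}{k+\beta}$. 1. If $\mu\le\frac{\beta+1}{4}$ and the stopping index $k(\delta)$ is chosen of the order $k(\delta)\asymp\delta^{-\frac{1}{2\mu+1}}$ as $\delta\to0$, then $$\|x_{k(\delta)}^\delta-x^\dagger\|=O\left(\delta^{\frac{2\mu}{2\mu+1}}\right)\qquad\text{as }\delta\to0.$$ 2. If $\mu>\frac{\beta+1}{4}$ and the stopping index $k(\delta)$ is chosen of the order $k(\delta)\asymp\delta^{-\frac{1}{\mu+\frac{\beta+1}{4}+1}}$ as $\delta\to0$, then $$\|x_{k(\delta)}^\delta-x^\dagger\|=O\left(\delta^{\frac{\mu+\frac{\beta+1}{4}}{\mu+\frac{\beta+1}{4}+1}}\right)\qquad\text{as }\delta\to0.$$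
   Context: The Nesterov iteration with data $y^\delta$ is $$x_0^\delta=0,\quad x_1^\delta=A^*y^\delta,\quad z_k^\delta=x_k^\delta+\alpha_k(x_k^\delta-x_{k-1}^\delta),\quad x_{k+1}^\delta=z_k^\delta+A^*(y^\delta-Az_k^\delta),\qquad k\ge 1.$$ The element $x^\dagger\in X$ is the minimum-norm solution of $Ax=y$ with exact data $y=Ax^\dagger$ (i.e. $x^\dagger\in\ker(A)^\perp$). For each noise level $\delta>0$, $y^\delta$ denotes noisy data with $\|Ax^\dagger-y^\delta\|=\delta$. The power $(A^*A)^\mu$ is defined by the spectral functional calculus. The notation $k(\delta)\asymp f(\delta)$ as $\delta\to 0$ means that there are constants $0<c_1\le c_2$ with $c_1f(\delta)\le k(\delta)\le c_2f(\delta)$ for all sufficiently small $\delta>0$; here $k(\delta)$ is a positive integer. *)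

theory Defs
  imports "HOL-Analysis.Analysis" "HOL-Library.Landau_Symbols"
begin

text \<open>
  For a bounded linear map between Hilbert spaces, \<^const>\<open>adjoint\<close> is the Hilbert space adjoint
  (it exists by the Riesz representation theorem and is unique).
  The iteration uses the momentum parameters \<open>\<alpha> k\<close> only for \<open>k \<ge> 1\<close>.
\<close>

fun nesterov :: "('a::real_inner \<Rightarrow> 'b::real_inner) \<Rightarrow> (nat \<Rightarrow> real) \<Rightarrow> 'b \<Rightarrow> nat \<Rightarrow> 'a" where
  "nesterov A \<alpha> y 0 = 0"
| "nesterov A \<alpha> y (Suc 0) = adjoint A y"
| "nesterov A \<alpha> y (Suc (Suc n)) =
     (let z = nesterov A \<alpha> y (Suc n)
              + \<alpha> (Suc n) *\<^sub>R (nesterov A \<alpha> y (Suc n) - nesterov A \<alpha> y n)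
      in z + adjoint A (y - A z))"

definition spectrum_op :: "('a::real_normed_vector \<Rightarrow> 'a) \<Rightarrow> real set" where
  "spectrum_op T = {l. \<not> (\<exists>R. bounded_linear R \<and>
     (\<forall>x. R (T x - l *\<^sub>R x) = x) \<and> (\<forall>x. T (R x) - l *\<^sub>R R x = x))}"

definition poly_op :: "real poly \<Rightarrow> ('a::real_vector \<Rightarrow> 'a) \<Rightarrow> 'a \<Rightarrow> 'a" where
  "poly_op p T x = (\<Sum>i\<le>degree p. coeff p i *\<^sub>R (T ^^ i) x)"

text \<open>
  The spectral (continuous) functional calculus \<open>f(T)\<close> of a bounded self-adjoint operator \<open>T\<close> on a
  Hilbert space, for \<open>f\<close> continuous on the spectrum of \<open>T\<close> (which is a compact set of reals, also
  over the real scalar field): \<open>f(T)\<close> is the limit in operator norm of \<open>p\<^sub>n(T)\<close> for polynomials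
  \<open>p\<^sub>n\<close> converging to \<open>f\<close> uniformly on the spectrum. The limit exists and is the same for all such
  sequences, because the norm of \<open>p(T)\<close> is the supremum of \<open>\<bar>p\<bar>\<close> over the spectrum.
\<close>

definition fun_calc :: "('a::real_normed_vector \<Rightarrow> 'a) \<Rightarrow> (real \<Rightarrow> real) \<Rightarrow> 'a \<Rightarrow> 'a" where
  "fun_calc T f = (THE S. bounded_linear S \<and>
     (\<forall>p :: nat \<Rightarrow> real poly.
        uniform_limit (spectrum_op T) (\<lambda>n. poly (p n)) f sequentially \<longrightarrow>
        (\<lambda>n. onorm (\<lambda>x. poly_op (p n) T x - S x)) \<longlonglongrightarrow> 0))"

text \<open>
  Intended for positive \<open>T\<close> and \<open>\<mu> > 0\<close>; as \<open>0 powr \<mu> = 0\<close>, the function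
  \<open>t \<mapsto> t powr \<mu>\<close> is then continuous on the spectrum, including at \<open>0\<close>.
\<close>

definition power_op :: "('a::real_normed_vector \<Rightarrow> 'a) \<Rightarrow> real \<Rightarrow> 'a \<Rightarrow> 'a" where
  "power_op T \<mu> = fun_calc T (\<lambda>t. t powr \<mu>)"

end

theory Submission
  imports Defs "HOL-Real_Asymp.Real_Asymp" "HOL-Computational_Algebra.Fundamental_Theorem_Algebra"
begin

text \<open>
  Write \<open>T = A\<^sup>*A\<close> and \<open>\<nu> = (\<beta> + 1) / 2\<close>. The iterates are polynomials in \<open>T\<close> applied to \<open>A\<^sup>*y\<close>,
  say \<open>g\<^sub>k(T) A\<^sup>*y\<close>, so the error splits as
  \<open>x\<^sub>k - x\<^sup>\<dagger> = - r\<^sub>k(T) T\<^sup>\<mu> \<omega> - g\<^sub>k(T) A\<^sup>* (A x\<^sup>\<dagger> - y)\<close> with the residual polynomial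
  \<open>r\<^sub>k(t) = 1 - t g\<^sub>k(t)\<close>. The spectrum of \<open>T\<close> lies in the unit interval, hence both parts are
  controlled by suprema of real functions over that interval: \<open>\<bar>r\<^sub>k(t)\<bar> t\<^sup>\<mu>\<close> for the
  approximation error and \<open>sqrt t \<bar>g\<^sub>k(t)\<bar>\<close> for the propagated noise. The second one is at most
  \<open>sqrt 2 k\<close>, which follows from \<open>\<bar>r\<^sub>k\<bar> \<le> 1\<close> and the recursion. The first one is at most a multiple of
  \<open>k\<close> to the power \<open>- \<rho>\<close> with \<open>\<rho> = min (2 \<mu>) (\<mu> + \<nu> / 2)\<close>, which is the heart of the matter;
  the saturation at \<open>\<mu> = \<nu> / 2\<close> separates the two cases of the theorem. Balancing
  the contributions \<open>k\<close> to the power \<open>- \<rho>\<close> and \<open>k \<delta>\<close> gives the stated stopping index and rate.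

  The bound for the residual polynomials (lemma \<open>residual_rate\<close>) comes from
  \<open>r\<^sub>n\<^sub>+\<^sub>1(t) = s\<^sup>n\<^sup>+\<^sup>2 q\<^sub>n(s)\<close>, where \<open>s = sqrt (1 - t)\<close> and \<open>q\<^sub>n\<close> is the Gegenbauer polynomial
  of order \<open>\<nu>\<close> normalised to the value 1 at 1, and from the decay
  \<open>\<bar>q\<^sub>n(s)\<bar> = O((n sqrt t) powr - \<nu>)\<close> (lemma \<open>gegenbauer_decay\<close>). The decay is obtained from the
  three-term recurrence alone, by a discrete version of Sonin's argument: after multiplication by
  \<open>(n + \<nu>) powr \<nu>\<close> the recurrence becomes that of a harmonic oscillator, with damping and
  change of frequency of order \<open>n\<close> to the power \<open>-3\<close> per step, the energy of the oscillator is comparable to the squared amplitude with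
  constant \<open>t\<close> as soon as \<open>n sqrt t\<close> is large, and from there on it stays bounded by a discrete
  Gronwall inequality.

  On the operator side, the existence of the adjoint is the Riesz representation theorem, and the
  functional calculus exists because \<open>\<parallel>p(T)\<parallel>\<close> is at most the supremum of \<open>\<bar>p\<bar>\<close> over the spectrum
  (lemma \<open>norm_poly_op_le_spectrum\<close>).
\<close>

section \<open>Polynomials of a bounded operator\<close>

lemma poly_op_0 [simp]: "poly_op 0 T x = 0"
  by (simp add: poly_op_def)

lemma poly_op_altdef:
  assumes "degree p \<le> n"
  shows "poly_op p T x = (\<Sum>i\<le>n. coeff p i *\<^sub>R (T ^^ i) x)"
  unfolding poly_op_def using assms
  by (intro sum.mono_neutral_left) (auto simp: coeff_eq_0)

lemma poly_op_pCons:
  assumes "linear T"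
  shows "poly_op (pCons a p) T x = a *\<^sub>R x + T (poly_op p T x)"
proof -
  have "poly_op (pCons a p) T x = (\<Sum>i\<le>Suc (degree p). coeff (pCons a p) i *\<^sub>R (T ^^ i) x)"
    by (rule poly_op_altdef) (simp add: degree_pCons_le)
  also have "\<dots> = a *\<^sub>R x + (\<Sum>i\<le>degree p. coeff p i *\<^sub>R (T ^^ Suc i) x)"
    by (subst sum.atMost_Suc_shift) simp
  also have "(\<Sum>i\<le>degree p. coeff p i *\<^sub>R (T ^^ Suc i) x) = T (poly_op p T x)"
    unfolding poly_op_def by (simp add: linear_sum[OF assms] linear_cmul[OF assms])
  finally show ?thesis .
qed

lemma poly_op_add:
  "poly_op (p + q) T x = poly_op p T x + poly_op q T x"
  by (simp add: poly_op_altdef[of _ "max (degree p) (degree q)"] degree_add_le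
      sum.distrib scaleR_add_left)

lemma poly_op_smult: "poly_op (smult c p) T x = c *\<^sub>R poly_op p T x"
  by (simp add: poly_op_altdef[of _ "degree p"] degree_smult_le scaleR_sum_right)

lemma poly_op_diff: "poly_op (p - q) T x = poly_op p T x - poly_op q T x"
  using poly_op_add[of p "smult (-1) q" T x] poly_op_smult[of "-1" q T x] by simp

lemma poly_op_const: "linear T \<Longrightarrow> poly_op [:c:] T x = c *\<^sub>R x"
  by (simp add: poly_op_pCons linear_0)

lemma poly_op_1 [simp]: "poly_op 1 T x = x"
  by (simp add: poly_op_def)

lemma bounded_linear_poly_op:
  assumes "bounded_linear T"
  shows "bounded_linear (poly_op p T)"
proof (induction p)
  case (pCons a p)
  have "poly_op (pCons a p) T = (\<lambda>x. a *\<^sub>R x + T (poly_op p T x))"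
    by (rule ext, rule poly_op_pCons) (rule bounded_linear.linear[OF assms])
  then show ?case
    using bounded_linear_compose[OF assms pCons(2)]
    by (simp add: bounded_linear_add bounded_linear_scaleR_right)
qed (simp add: bounded_linear_zero)

lemma poly_op_mult:
  assumes "bounded_linear T"
  shows "poly_op (p * q) T x = poly_op p T (poly_op q T x)"
proof (induction p)
  case (pCons a p)
  then show ?case
    by (simp add: poly_op_add poly_op_smult poly_op_pCons bounded_linear.linear[OF assms])
qed simp

lemma poly_op_commute:
  assumes "bounded_linear T"
  shows "poly_op p T (poly_op q T x) = poly_op q T (poly_op p T x)"
  by (metis assms mult.commute poly_op_mult)

lemma poly_op_self_adjoint:
  assumes "bounded_linear T" and "\<And>x y. inner (T x) y = inner x (T y)"
  shows "inner (poly_op p T x) y = inner x (poly_op p T y)"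
proof (induction p arbitrary: x y)
  case (pCons a p)
  have "T (poly_op p T y) = poly_op p T (T y)" for y
    using poly_op_commute[OF assms(1), of p "[:0,1:]" y]
    by (simp add: poly_op_pCons bounded_linear.linear[OF assms(1)] linear_0)
  with pCons show ?case
    by (simp add: poly_op_pCons bounded_linear.linear[OF assms(1)] inner_add_left inner_add_right assms(2))
qed simp

text \<open>
  A complex root of \<open>q\<close> is either real, or it is the root of a real quadratic \<open>(t - a)\<^sup>2 + b\<^sup>2\<close>
  with \<open>b \<noteq> 0\<close>, and the remainder of the division by that quadratic vanishes at a non-real point
  while having degree at most one. Inserting a self-adjoint operator,
  both kinds of factors can be bounded below within the real Hilbert space, so that no
  complexification is involved.
\<close>

lemma real_poly_linear_or_quadratic_factor:
  fixes q :: "real poly"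
  assumes "degree q > 0"
  obtains (linear) l h where "q = [:- l, 1:] * h"
    | (quadratic) a b h where "b \<noteq> 0" "q = ([:- a, 1:] ^ 2 + [:b ^ 2:]) * h"
proof -
  let ?Q = "map_poly complex_of_real q"
  have ev: "poly (map_poly complex_of_real p) (complex_of_real x) = complex_of_real (poly p x)" for p x
    by (induction p) (auto simp: map_poly_pCons)
  have "degree ?Q > 0" using assms by (simp add: degree_map_poly)
  then obtain z where z: "poly ?Q z = 0"
    by (metis constant_degree fundamental_theorem_of_algebra not_gr_zero)
  show thesis
  proof (cases "Im z = 0")
    case True
    then have "z = complex_of_real (Re z)" by (simp add: complex_eq_iff)
    then have "poly q (Re z) = 0" using ev[of q "Re z"] z by (metis of_real_eq_0_iff)
    then show thesis using linear by (auto simp: poly_eq_0_iff_dvd elim!: dvdE)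
  next
    case False
    let ?d = "[:- Re z, 1:] ^ 2 + [:Im z ^ 2:] :: real poly"
    have d: "?d = [:Re z ^ 2 + Im z ^ 2, - 2 * Re z, 1:]"
      by (simp add: power2_eq_square)
    define r where "r = q mod ?d"
    have "degree r < 2" 
      using degree_mod_less'[of ?d q] unfolding r_def d by (cases "q mod [:Re z ^ 2 + Im z ^ 2, - 2 * Re z, 1:] = 0") auto
    define u v where "u = coeff r 0" and "v = coeff r 1"
    have r: "r = [:u, v:]"
      unfolding u_def v_def using \<open>degree r < 2\<close>
      by (intro poly_eqI) (auto simp: coeff_pCons coeff_eq_0 split: nat.splits)
    have q: "q = ?d * (q div ?d) + r" unfolding r_def by simp
    have mult: "map_poly complex_of_real (p * p') = map_poly complex_of_real p * map_poly complex_of_real p'" for p p'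
      by (rule poly_eqI) (simp add: coeff_map_poly coeff_mult)
    have add: "map_poly complex_of_real (p + p') = map_poly complex_of_real p + map_poly complex_of_real p'" for p p'
      by (rule poly_eqI) (simp add: coeff_map_poly)
    have "poly (map_poly complex_of_real ?d) z = 0"
      unfolding d by (simp add: map_poly_pCons complex_eq_iff algebra_simps power2_eq_square)
    then have "poly (map_poly complex_of_real r) z = 0"
      using z by (subst (asm) q) (simp add: mult add)
    then have "v = 0" "u = 0"
      using False unfolding r by (auto simp: map_poly_pCons complex_eq_iff)
    then show thesis using quadratic[of "Im z" "Re z" "q div ?d"] False q r by simp
  qed
qed

definition bounded_below :: "('a::real_normed_vector \<Rightarrow> 'a) \<Rightarrow> bool" where
  "bounded_below B \<longleftrightarrow> (\<exists>c>0. \<forall>x. c * norm x \<le> norm (B x))"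

lemma bounded_below_compose:
  assumes "bounded_below B" "bounded_below C"
  shows "bounded_below (\<lambda>x. B (C x))"
proof -
  obtain b c where "b > 0" "c > 0" and *: "\<And>x. b * norm x \<le> norm (B x)" "\<And>x. c * norm x \<le> norm (C x)"
    using assms unfolding bounded_below_def by blast
  have "(b * c) * norm x \<le> norm (B (C x))" for x
  proof -
    have "(b * c) * norm x \<le> b * norm (C x)"
      using *(2)[of x] \<open>b > 0\<close> by (simp add: mult.assoc)
    also have "\<dots> \<le> norm (B (C x))"
      by (rule *(1))
    finally show ?thesis .
  qed
  then show ?thesis unfolding bounded_below_def using \<open>b > 0\<close> \<open>c > 0\<close> by (meson mult_pos_pos)
qed

lemma not_in_spectrum_imp_bounded_below:
  assumes "l \<notin> spectrum_op T"
  shows "bounded_below (\<lambda>x. T x - l *\<^sub>R x)"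
proof -
  obtain R where R: "bounded_linear R" "\<And>x. R (T x - l *\<^sub>R x) = x"
    using assms unfolding spectrum_op_def by auto
  obtain K where K: "K > 0" "\<And>x. norm (R x) \<le> norm x * K"
    using bounded_linear.pos_bounded[OF R(1)] by auto
  have "1 / K * norm x \<le> norm (T x - l *\<^sub>R x)" for x
    using K(2)[of "T x - l *\<^sub>R x"] K(1) R(2)[of x] by (simp add: field_simps)
  then show ?thesis unfolding bounded_below_def using K by (intro exI[of _ "1 / K"]) auto
qed

text \<open>
  The half of the spectral mapping theorem that the norm bound below needs. A linear factor has its
  root outside the spectrum, so it is bounded below by the resolvent; a quadratic factor
  \<open>(T - a)\<^sup>2 + b\<^sup>2\<close> is bounded below by \<open>b\<^sup>2\<close> because the square of a self-adjoint operator is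
  nonnegative.
\<close>

lemma bounded_below_poly_op:
  fixes T :: "'a::real_inner \<Rightarrow> 'a"
  assumes T: "bounded_linear T" and sa: "\<And>x y. inner (T x) y = inner x (T y)"
  shows "q \<noteq> 0 \<Longrightarrow> (\<And>l. l \<in> spectrum_op T \<Longrightarrow> poly q l \<noteq> 0) \<Longrightarrow> bounded_below (poly_op q T)"
proof (induction "degree q" arbitrary: q rule: less_induct)
  case less
  note lin = bounded_linear.linear[OF T]
  have lin_factor: "poly_op [:- l, 1:] T = (\<lambda>x. T x - l *\<^sub>R x)" for l
    by (rule ext) (simp add: poly_op_pCons lin linear_0)
  show ?case
  proof (cases "degree q = 0")
    case True
    then obtain c where c: "q = [:c:]" by (metis degree_eq_zeroE)
    with less(2) have "c \<noteq> 0" by simp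
    then show ?thesis unfolding bounded_below_def c
      by (intro exI[of _ "\<bar>c\<bar>"]) (simp add: poly_op_const lin)
  next
    case False
    then have "degree q > 0" by simp
    then show ?thesis
    proof (cases rule: real_poly_linear_or_quadratic_factor)
      case (linear l h)
      have "h \<noteq> 0" using less(2) linear by auto
      have deg: "degree q = Suc (degree h)"
        unfolding linear(1) using \<open>h \<noteq> 0\<close> by (subst degree_mult_eq) auto
      have "bounded_below (poly_op h T)"
      proof (rule less(1))
        show "degree h < degree q" by (simp add: deg)
        show "poly h m \<noteq> 0" if "m \<in> spectrum_op T" for m
          using less(3)[OF that] unfolding linear(1) by simp
      qed fact
      moreover have "bounded_below (poly_op [:- l, 1:] T)"
        unfolding lin_factor using less(3)[of l] linear
        by (intro not_in_spectrum_imp_bounded_below) auto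
      ultimately have "bounded_below (\<lambda>x. poly_op [:- l, 1:] T (poly_op h T x))"
        by (rule bounded_below_compose[rotated])
      then show ?thesis
        by (simp add: linear(1) poly_op_mult[OF T] bounded_below_def del: mult_pCons_left)
    next
      case (quadratic a b h)
      let ?d = "[:- a, 1:] ^ 2 + [:b ^ 2:] :: real poly"
      have "h \<noteq> 0" using less(2) quadratic by auto
      have d: "degree ?d = 2" by (simp add: power2_eq_square)
      have "?d \<noteq> 0" by (simp add: power2_eq_square)
      with d have deg: "degree q = 2 + degree h"
        unfolding quadratic(2) using \<open>h \<noteq> 0\<close> by (subst degree_mult_eq) auto
      have "bounded_below (poly_op h T)"
      proof (rule less(1))
        show "degree h < degree q" by (simp add: deg)
        show "poly h m \<noteq> 0" if "m \<in> spectrum_op T" for m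
          using less(3)[OF that] unfolding quadratic(2) by simp
      qed fact
      moreover have "bounded_below (poly_op ?d T)"
      proof -
        have "b ^ 2 * norm x \<le> norm (poly_op ?d T x)" for x
        proof (cases "x = 0")
          case False
          let ?N = "poly_op [:- a, 1:] T"
          have "inner (poly_op ?d T x) x = inner (?N (?N x)) x + b ^ 2 * inner x x"
            by (simp add: poly_op_add power2_eq_square[of "[:- a, 1:]"] poly_op_mult[OF T] inner_add_left poly_op_const[OF lin]
                del: mult_pCons_left mult_pCons_right)
          also have "inner (?N (?N x)) x = inner (?N x) (?N x)"
            by (rule poly_op_self_adjoint[OF T sa])
          finally have "b ^ 2 * norm x * norm x \<le> inner (poly_op ?d T x) x"
            by (simp add: power2_norm_eq_inner[symmetric] power2_eq_square)
          also have "\<dots> \<le> norm (poly_op ?d T x) * norm x"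
            by (rule norm_cauchy_schwarz)
          finally show ?thesis using False by simp
        qed simp
        then show ?thesis unfolding bounded_below_def using quadratic(1) by (intro exI[of _ "b ^ 2"]) auto
      qed
      ultimately have "bounded_below (\<lambda>x. poly_op ?d T (poly_op h T x))"
        by (rule bounded_below_compose[rotated])
      then show ?thesis
        unfolding quadratic(2) by (simp only: poly_op_mult[OF T] bounded_below_def)
    qed
  qed
qed

section \<open>The Riesz representation and the adjoint\<close>

text \<open>
  The representing vector is the minimiser of \<open>\<parallel>x\<parallel>\<^sup>2 - 2 f x\<close>: by the parallelogram identity every
  minimising sequence is Cauchy, and the vanishing of the first variation at the minimiser \<open>z\<close> is
  the identity \<open>f x = inner x z\<close>.
\<close>

lemma riesz_representation_real:
  fixes f :: "'a::{real_inner, complete_space} \<Rightarrow> real"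
  assumes "bounded_linear f"
  obtains z where "\<And>x. f x = inner x z"
proof -
  interpret f: bounded_linear f by fact
  define J where "J = (\<lambda>x. norm x ^ 2 - 2 * f x)"
  obtain K where K: "\<And>x. \<bar>f x\<bar> \<le> norm x * K"
    using f.bounded by auto
  have lower: "- (K ^ 2) \<le> J x" for x
  proof -
    have "f x \<le> norm x * K" using K[of x] by linarith
    then have "- (K ^ 2) \<le> J x - (norm x - K) ^ 2"
      by (simp add: J_def power2_diff)
    then show ?thesis using zero_le_power2[of "norm x - K"] by linarith
  qed
  define m where "m = Inf (range J)"
  have m_le: "m \<le> J x" for x
    unfolding m_def by (rule cInf_lower) (auto intro!: bdd_belowI2[OF lower])
  have "\<exists>x. J x < m + e" if "e > 0" for e
    using cInf_lessD[of "range J" "m + e"] that unfolding m_def by auto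
  then have "\<forall>n. \<exists>x. J x < m + 1 / real (Suc n)"
    by simp
  then obtain u where u: "\<And>n. J (u n) < m + 1 / real (Suc n)"
    by metis
  have parallelogram: "norm (a - b) ^ 2 = 2 * (J a + J b - 2 * J ((1/2) *\<^sub>R (a + b)))" for a b
    by (simp add: J_def f.add f.scaleR power2_norm_eq_inner inner_add_left inner_add_right
        inner_diff_left inner_diff_right inner_commute algebra_simps)
  have gap: "norm (u i - u j) ^ 2 \<le> 4 / real (Suc N)" if "N \<le> i" "N \<le> j" for i j N
  proof -
    have "1 / real (Suc i) \<le> 1 / real (Suc N)" "1 / real (Suc j) \<le> 1 / real (Suc N)"
      using that by (auto intro!: divide_left_mono)
    then show ?thesis
      using parallelogram[of "u i" "u j"] u[of i] u[of j] m_le[of "(1/2) *\<^sub>R (u i + u j)"] by simp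
  qed
  have "Cauchy u"
  proof (rule metric_CauchyI)
    fix e :: real assume "e > 0"
    obtain N where "4 / e ^ 2 < real N"
      using reals_Archimedean2 by blast
    then have N: "4 / e ^ 2 < real (Suc N)"
      by simp
    have "dist (u i) (u j) < e" if "N \<le> i" "N \<le> j" for i j
    proof -
      have "4 / real (Suc N) < e ^ 2"
        using N \<open>e > 0\<close> by (simp add: field_simps)
      then have "norm (u i - u j) ^ 2 < e ^ 2"
        using gap[OF that] by linarith
      then show ?thesis
        using \<open>e > 0\<close> power_less_imp_less_base[of "norm (u i - u j)" 2 e] by (simp add: dist_norm)
    qed
    then show "\<exists>M. \<forall>i\<ge>M. \<forall>j\<ge>M. dist (u i) (u j) < e" by blast
  qed
  then obtain z where z: "u \<longlonglongrightarrow> z"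
    using Cauchy_convergent convergent_def by blast
  have "(\<lambda>n. J (u n)) \<longlonglongrightarrow> J z"
    unfolding J_def by (intro tendsto_intros f.tendsto z)
  moreover have "(\<lambda>n. m + 1 / real (Suc n)) \<longlonglongrightarrow> m + 0"
    using LIMSEQ_inverse_real_of_nat by (intro tendsto_intros) (simp add: inverse_eq_divide)
  ultimately have "J z \<le> m + 0"
    using u by (intro tendsto_le[of sequentially]) (auto intro!: always_eventually less_imp_le)
  then have min: "J z \<le> J x" for x
    using m_le[of x] by simp
  have "f x = inner x z" for x
  proof (cases "x = 0")
    case False
    then have pos: "norm x ^ 2 > 0" by simp
    define d where "d = f x - inner x z"
    \<comment> \<open>the step length that minimises \<open>J (z + t x)\<close> over \<open>t\<close>\<close>
    define t where "t = d / norm x ^ 2"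
    have "norm (z + t *\<^sub>R x) ^ 2 = norm z ^ 2 + t ^ 2 * norm x ^ 2 + 2 * t * inner x z"
      by (simp add: power2_norm_eq_inner inner_add_left inner_add_right inner_commute
          power2_eq_square[of t] algebra_simps)
    then have "J (z + t *\<^sub>R x) = J z + t ^ 2 * norm x ^ 2 - 2 * t * d"
      by (simp add: J_def d_def f.add f.scaleR algebra_simps)
    also have "t ^ 2 * norm x ^ 2 - 2 * t * d = - (d ^ 2 / norm x ^ 2)"
      using pos unfolding t_def by (simp add: power2_eq_square)
    then have "J z + t ^ 2 * norm x ^ 2 - 2 * t * d = J z - d ^ 2 / norm x ^ 2" by linarith
    finally have "d ^ 2 / norm x ^ 2 \<le> 0"
      using min[of "z + t *\<^sub>R x"] by simp
    then have "d = 0"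
      using pos by (simp add: divide_le_0_iff)
    then show ?thesis unfolding d_def by simp
  qed simp
  then show thesis using that by blast
qed

lemma adjoint_hilbert:
  fixes A :: "'a::{real_inner, complete_space} \<Rightarrow> 'b::real_inner"
  assumes "bounded_linear A"
  shows "inner (A x) y = inner x (adjoint A y)"
proof -
  have "\<exists>z. \<forall>x. inner (A x) y = inner x z" for y
    using riesz_representation_real[of "\<lambda>x. inner (A x) y"]
      bounded_linear_compose[OF bounded_linear_inner_left assms] by metis
  then have "\<exists>A'. \<forall>x y. inner (A x) y = inner x (A' y)"
    by metis
  then show ?thesis
    unfolding adjoint_def by (rule someI2_ex) blast
qed

lemma bounded_linear_adjoint_hilbert:
  fixes A :: "'a::{real_inner, complete_space} \<Rightarrow> 'b::real_inner"
  assumes "bounded_linear A"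
  shows "bounded_linear (adjoint A)"
proof -
  note adj = adjoint_hilbert[OF assms, symmetric]
  obtain K where "K \<ge> 0" and K: "\<And>x. norm (A x) \<le> norm x * K"
    using bounded_linear.nonneg_bounded[OF assms] by auto
  show ?thesis
  proof (rule bounded_linear_intro[where K = K])
    show "adjoint A (y + z) = adjoint A y + adjoint A z" for y z
      by (rule vector_eq_rdot[THEN iffD1]) (simp add: inner_commute[of _ "_::'a"] inner_add_right adj)
    show "adjoint A (r *\<^sub>R y) = r *\<^sub>R adjoint A y" for r y
      by (rule vector_eq_rdot[THEN iffD1]) (simp add: inner_commute[of _ "_::'a"] adj)
    show "norm (adjoint A y) \<le> norm y * K" for y
    proof (cases "adjoint A y = 0")
      case True
      then show ?thesis using \<open>K \<ge> 0\<close> by simp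
    next
      case False
      have "norm (adjoint A y) ^ 2 = inner (A (adjoint A y)) y"
        by (simp add: power2_norm_eq_inner adj[symmetric])
      also have "\<dots> \<le> norm (A (adjoint A y)) * norm y"
        by (rule norm_cauchy_schwarz)
      also have "\<dots> \<le> (norm (adjoint A y) * K) * norm y"
        by (intro mult_right_mono K) simp
      finally show ?thesis
        using False by (simp add: power2_eq_square mult.assoc mult.commute[of K])
    qed
  qed
qed

section \<open>The spectrum of a positive contraction\<close>

text \<open>
  The equation \<open>c x - B x = y\<close> is the fixed point equation of \<open>x \<mapsto> (y + B x) / c\<close>, a strict
  contraction.
\<close>

lemma contraction_shift_inverse:
  fixes B :: "'a::{real_normed_vector, complete_space} \<Rightarrow> 'a"
  assumes B: "bounded_linear B" "\<And>x. norm (B x) \<le> norm x" and c: "c > 1"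
  shows "\<exists>R. bounded_linear R \<and> (\<forall>x. R (c *\<^sub>R x - B x) = x) \<and> (\<forall>x. c *\<^sub>R R x - B (R x) = x)"
proof -
  interpret B: bounded_linear B by fact
  have "\<exists>x. c *\<^sub>R x - B x = y" for y
  proof -
    have "\<exists>!x. (1 / c) *\<^sub>R (y + B x) = x"
    proof (rule banach_fix_type[of "1 / c"])
      show "\<forall>u v. dist ((1 / c) *\<^sub>R (y + B u)) ((1 / c) *\<^sub>R (y + B v)) \<le> 1 / c * dist u v"
      proof (intro allI)
        fix u v
        have "(1 / c) *\<^sub>R (y + B u) - (1 / c) *\<^sub>R (y + B v) = (1 / c) *\<^sub>R B (u - v)"
          by (simp add: B.diff flip: scaleR_diff_right)
        then show "dist ((1 / c) *\<^sub>R (y + B u)) ((1 / c) *\<^sub>R (y + B v)) \<le> 1 / c * dist u v"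
          using c B(2)[of "u - v"] by (simp add: dist_norm divide_right_mono)
      qed
    qed (use c in auto)
    then obtain x where x: "(1 / c) *\<^sub>R (y + B x) = x" by blast
    have "c *\<^sub>R x = c *\<^sub>R ((1 / c) *\<^sub>R (y + B x))" by (simp only: x)
    also have "\<dots> = y + B x" using c by simp
    finally show ?thesis by (intro exI[of _ x]) simp
  qed
  then obtain R where R: "\<And>y. c *\<^sub>R R y - B (R y) = y" by metis
  have low: "(c - 1) * norm x \<le> norm (c *\<^sub>R x - B x)" for x
    using norm_triangle_ineq2[of "c *\<^sub>R x" "B x"] B(2)[of x] c by (simp add: algebra_simps)
  have inj: "x = x'" if "c *\<^sub>R x - B x = c *\<^sub>R x' - B x'" for x x'
  proof -
    have "c *\<^sub>R (x - x') - B (x - x') = 0"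
      using that by (simp add: B.diff scaleR_diff_right algebra_simps)
    then have "(c - 1) * norm (x - x') \<le> 0" using low[of "x - x'"] by simp
    then show ?thesis using c by (simp add: mult_le_0_iff)
  qed
  show ?thesis
  proof (intro exI conjI allI)
    show "bounded_linear R"
    proof (rule bounded_linear_intro[where K = "1 / (c - 1)"])
      show "R (x + y) = R x + R y" for x y
      proof (rule inj)
        have "c *\<^sub>R (R x + R y) - B (R x + R y) = (c *\<^sub>R R x - B (R x)) + (c *\<^sub>R R y - B (R y))"
          by (simp add: B.add scaleR_add_right)
        then show "c *\<^sub>R R (x + y) - B (R (x + y)) = c *\<^sub>R (R x + R y) - B (R x + R y)"
          by (simp only: R)
      qed
      show "R (r *\<^sub>R x) = r *\<^sub>R R x" for r x
      proof (rule inj)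
        have "c *\<^sub>R r *\<^sub>R R x - B (r *\<^sub>R R x) = r *\<^sub>R (c *\<^sub>R R x - B (R x))"
          by (simp add: B.scaleR scaleR_diff_right)
        then show "c *\<^sub>R R (r *\<^sub>R x) - B (R (r *\<^sub>R x)) = c *\<^sub>R r *\<^sub>R R x - B (r *\<^sub>R R x)"
          by (simp only: R)
      qed
      show "norm (R x) \<le> norm x * (1 / (c - 1))" for x
        using low[of "R x"] c unfolding R by (simp add: field_simps)
    qed
    show "R (c *\<^sub>R x - B x) = x" for x
      by (rule inj) (rule R)
  qed (rule R)
qed

text \<open>
  The last assumption is the operator inequality \<open>T\<^sup>2 \<le> T\<close>, which for self-adjoint \<open>T\<close> encodes
  \<open>0 \<le> T \<le> 1\<close> in a form that yields bounds for both \<open>T\<close> and \<open>1 - T\<close> at once.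
\<close>

locale positive_contraction =
  fixes T :: "'a::{real_inner, complete_space} \<Rightarrow> 'a"
  assumes bounded_linear_T: "bounded_linear T"
    and self_adjoint: "inner (T x) y = inner x (T y)"
    and square_le: "norm (T x) ^ 2 \<le> inner (T x) x"
begin

lemma norm_T_le: "norm (T x) \<le> norm x"
proof (cases "T x = 0")
  case False
  have "norm (T x) * norm (T x) \<le> norm (T x) * norm x"
    using square_le[of x] norm_cauchy_schwarz[of "T x" x] by (simp add: power2_eq_square)
  then show ?thesis using False by simp
qed simp

lemma norm_complement_le: "norm (x - T x) \<le> norm x"
proof -
  have "norm (x - T x) ^ 2 = norm x ^ 2 - 2 * inner (T x) x + norm (T x) ^ 2"
    by (simp add: power2_norm_eq_inner inner_diff_left inner_diff_right inner_commute)
  also have "\<dots> \<le> norm x ^ 2"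
    using square_le[of x] zero_le_power2[of "norm (T x)"] by linarith
  finally show ?thesis by (rule power2_le_imp_le) simp
qed

text \<open>
  Both \<open>T\<close> and \<open>1 - T\<close> are contractions. So \<open>T - l\<close> is invertible for \<open>l > 1\<close>, and
  for \<open>l < 0\<close> one writes \<open>T - l = (1 - l) - (1 - T)\<close>.
\<close>

lemma spectrum_subset: "spectrum_op T \<subseteq> {0..1}"
proof
  fix l assume l: "l \<in> spectrum_op T"
  have "\<not> l > 1"
  proof
    assume "l > 1"
    then obtain R where R: "bounded_linear R" "\<And>x. R (l *\<^sub>R x - T x) = x" "\<And>x. l *\<^sub>R R x - T (R x) = x"
      using contraction_shift_inverse[OF bounded_linear_T norm_T_le, of l] by blast
    interpret R: bounded_linear R by fact
    interpret T: bounded_linear T by (rule bounded_linear_T)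
    have "- R (T x - l *\<^sub>R x) = x" for x
      using R(2)[of x] by (simp add: R.diff)
    moreover have "T (- R x) - l *\<^sub>R (- R x) = x" for x
      using R(3)[of x] by (simp add: T.neg)
    ultimately show False
      using l bounded_linear_minus[OF R(1)] unfolding spectrum_op_def by blast
  qed
  moreover have "\<not> l < 0"
  proof
    assume "l < 0"
    have "bounded_linear (\<lambda>x. x - T x)"
      by (intro bounded_linear_sub bounded_linear_ident bounded_linear_T)
    then obtain R where R: "bounded_linear R" "\<And>x. R ((1 - l) *\<^sub>R x - (x - T x)) = x"
      "\<And>x. (1 - l) *\<^sub>R R x - (R x - T (R x)) = x"
      using contraction_shift_inverse[OF _ norm_complement_le, of "1 - l"] \<open>l < 0\<close> by auto
    have "(1 - l) *\<^sub>R x - (x - T x) = T x - l *\<^sub>R x" for x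
      by (simp add: algebra_simps)
    with R show False
      using l unfolding spectrum_op_def by auto
  qed
  ultimately show "l \<in> {0..1}" by auto
qed

end

section \<open>The continuous functional calculus\<close>

context positive_contraction
begin

interpretation T: bounded_linear T
  by (rule bounded_linear_T)

lemma bounded_linear_poly: "bounded_linear (poly_op p T)"
  by (rule bounded_linear_poly_op[OF bounded_linear_T])

text \<open>
  If \<open>P = p(T)\<close> has norm \<open>M\<close>, then \<open>P\<^sup>2 - M\<^sup>2\<close> is not bounded below on a nontrivial space: on unit vectors almost
  attaining the norm, \<open>P\<^sup>2 x\<close> is close to \<open>M\<^sup>2 x\<close>. By lemma \<open>bounded_below_poly_op\<close> the polynomial
  \<open>p\<^sup>2 - M\<^sup>2\<close> then has a root in the spectrum, where \<open>\<bar>p\<bar> = M\<close>.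
\<close>

lemma norm_poly_op_le_spectrum:
  assumes "e \<ge> 0" and bound: "\<And>l. l \<in> spectrum_op T \<Longrightarrow> \<bar>poly p l\<bar> \<le> e"
  shows "norm (poly_op p T x) \<le> e * norm x"
proof -
  have attained: "\<exists>l\<in>spectrum_op T. poly p' l ^ 2 = onorm (poly_op p' T) ^ 2"
    if nonconst: "p' ^ 2 - [:onorm (poly_op p' T) ^ 2:] \<noteq> 0" and nontrivial: "(x::'a) \<noteq> 0" for p' x
  proof (rule ccontr)
    define M where "M = onorm (poly_op p' T)"
    let ?q = "p' ^ 2 - [:M ^ 2:]"
    interpret P: bounded_linear "poly_op p' T" by (rule bounded_linear_poly)
    assume "\<not> ?thesis"
    then have "bounded_below (poly_op ?q T)"
      using nonconst unfolding M_def
      by (intro bounded_below_poly_op[OF bounded_linear_T self_adjoint]) auto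
    then obtain c where c: "c > 0" "\<And>x. c * norm x \<le> norm (poly_op ?q T x)"
      unfolding bounded_below_def by blast
    have M: "norm (poly_op p' T x) \<le> M * norm x" for x
      unfolding M_def by (rule onorm[OF bounded_linear_poly])
    have "M \<ge> 0" unfolding M_def by (rule onorm_pos_le[OF bounded_linear_poly])
    \<comment> \<open>expand \<open>\<parallel>(P\<^sup>2 - M\<^sup>2) x\<parallel>\<^sup>2\<close> and use \<open>\<parallel>P\<^sup>2 x\<parallel> \<le> M \<parallel>P x\<parallel> \<le> M\<^sup>2 \<parallel>x\<parallel>\<close>\<close>
    have key: "c ^ 2 * norm x ^ 2 \<le> 2 * M ^ 2 * (M ^ 2 * norm x ^ 2 - norm (poly_op p' T x) ^ 2)" for x
    proof -
      let ?P = "poly_op p' T"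
      have q: "poly_op ?q T x = ?P (?P x) - M ^ 2 *\<^sub>R x"
        by (simp add: poly_op_diff power2_eq_square[of p'] poly_op_mult[OF bounded_linear_T]
            poly_op_const[OF T.linear])
      have "c ^ 2 * norm x ^ 2 \<le> norm (poly_op ?q T x) ^ 2"
        using power_mono[OF c(2)[of x], of 2] c(1) by (simp add: power_mult_distrib)
      also have "\<dots> = norm (?P (?P x)) ^ 2 - 2 * M ^ 2 * inner (?P (?P x)) x + M ^ 2 * M ^ 2 * norm x ^ 2"
        unfolding q power2_norm_eq_inner
        by (simp add: inner_diff_left inner_diff_right inner_commute algebra_simps)
      also have "inner (?P (?P x)) x = norm (?P x) ^ 2"
        by (simp add: poly_op_self_adjoint[OF bounded_linear_T self_adjoint] power2_norm_eq_inner)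
      also have "norm (?P (?P x)) ^ 2 \<le> M ^ 2 * norm (?P x) ^ 2"
        using power_mono[OF M[of "?P x"], of 2] by (simp add: power_mult_distrib)
      also have "M ^ 2 * norm (?P x) ^ 2 \<le> M ^ 2 * (M ^ 2 * norm x ^ 2)"
        using power_mono[OF M[of x], of 2] by (intro mult_left_mono) (auto simp: power_mult_distrib)
      finally show ?thesis by (simp add: algebra_simps)
    qed
    have "M > 0"
    proof (rule ccontr)
      assume "\<not> M > 0"
      with \<open>M \<ge> 0\<close> have "c ^ 2 * norm x ^ 2 \<le> 0"
        using key[of x] by simp
      moreover have "c ^ 2 * norm x ^ 2 > 0"
        using nontrivial c(1) by simp
      ultimately show False by linarith
    qed
    define d where "d = c ^ 2 / (2 * M ^ 2)"
    have "d > 0" unfolding d_def using c(1) \<open>M > 0\<close> by simp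
    have less: "norm (poly_op p' T x) ^ 2 \<le> (M ^ 2 - d) * norm x ^ 2" for x
      using key[of x] \<open>M > 0\<close> unfolding d_def by (simp add: field_simps)
    have "0 \<le> (M ^ 2 - d) * norm x ^ 2"
      by (rule order_trans[OF zero_le_power2 less])
    then have nn: "0 \<le> M ^ 2 - d"
      using nontrivial by (simp add: zero_le_mult_iff)
    have "norm (poly_op p' T x) \<le> sqrt (M ^ 2 - d) * norm x" for x
      using real_le_rsqrt[OF less[of x]] by (simp add: real_sqrt_mult)
    then have "M \<le> sqrt (M ^ 2 - d)"
      unfolding M_def using nn by (intro onorm_bound) (auto simp: M_def)
    also have "\<dots> < sqrt (M ^ 2)"
      using \<open>d > 0\<close> by (intro real_sqrt_less_mono) simp
    finally show False using \<open>M > 0\<close> by simp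
  qed
  show ?thesis
  proof (cases "x = 0")
    case True
    interpret P: bounded_linear "poly_op p T" by (rule bounded_linear_poly)
    show ?thesis by (simp add: True P.zero)
  next
    case False
    define M where "M = onorm (poly_op p T)"
    have "\<exists>l\<in>spectrum_op T. poly p l ^ 2 = M ^ 2"
    \<comment> \<open>for constant \<open>p\<close> it remains to see that the spectrum is nonempty, which follows with the identity polynomial\<close>
    proof (cases "p ^ 2 - [:M ^ 2:] = 0")
      case True
      have "[:0, 1:] ^ 2 - [:a:] \<noteq> 0" for a :: real
        by (simp add: power2_eq_square)
      then obtain l where "l \<in> spectrum_op T"
        using attained[of "[:0, 1:]"] \<open>x \<noteq> 0\<close> by blast
      moreover have "poly (p ^ 2 - [:M ^ 2:]) l = 0"
        by (simp only: True poly_0)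
      ultimately show ?thesis by auto
    next
      case False
      then show ?thesis using attained \<open>x \<noteq> 0\<close> unfolding M_def by blast
    qed
    then obtain l where "l \<in> spectrum_op T" "\<bar>poly p l\<bar> = \<bar>M\<bar>"
      by (auto simp: power2_eq_iff abs_eq_iff)
    then have "M \<le> e" using bound[of l] by simp
    then have "M * norm x \<le> e * norm x" by (intro mult_right_mono) auto
    moreover have "norm (poly_op p T x) \<le> M * norm x"
      unfolding M_def by (rule onorm[OF bounded_linear_poly])
    ultimately show ?thesis by linarith
  qed
qed

lemma norm_poly_op_le_unit_interval:
  assumes "\<And>t. t \<in> {0..1} \<Longrightarrow> \<bar>poly p t\<bar> \<le> e"
  shows "norm (poly_op p T x) \<le> e * norm x"
proof (rule norm_poly_op_le_spectrum)
  show "0 \<le> e" using assms[of 0] by simp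
qed (use assms spectrum_subset in blast)

end

text \<open>
  Bernstein's theorem, with the approximants as elements of the type of polynomials.
\<close>

lemma bernstein_polynomial_approx:
  fixes f :: "real \<Rightarrow> real"
  assumes "continuous_on {0..1} f"
  obtains p :: "nat \<Rightarrow> real poly" where "uniform_limit {0..1} (\<lambda>n. poly (p n)) f sequentially"
proof
  let ?p = "\<lambda>n. \<Sum>k\<le>n. smult (f (real k / real n) * real (n choose k)) ([:0, 1:] ^ k * [:1, -1:] ^ (n - k))"
  show "uniform_limit {0..1} (\<lambda>n. poly (?p n)) f sequentially"
  proof (rule uniform_limitI)
    fix e :: real assume "e > 0"
    then obtain N where "\<forall>n x. N \<le> n \<and> x \<in> {0..1} \<longrightarrow> \<bar>f x - (\<Sum>k\<le>n. f (real k / real n) * Bernstein n k x)\<bar> < e"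
      using Bernstein_Weierstrass[OF assms] by blast
    then have "\<forall>n\<ge>N. \<forall>x\<in>{0..1}. dist (poly (?p n) x) (f x) < e"
      by (auto simp: poly_sum Bernstein_def dist_real_def abs_minus_commute mult_ac algebra_simps)
    then show "\<forall>\<^sub>F n in sequentially. \<forall>x\<in>{0..1}. dist (poly (?p n) x) (f x) < e"
      unfolding eventually_sequentially by blast
  qed
qed

context positive_contraction
begin

text \<open>
  Polynomial sequences approximating \<open>f\<close> uniformly on the spectrum give operator-norm Cauchy
  sequences, because the norm of \<open>p(T)\<close> is bounded by the supremum of \<open>\<bar>p\<bar>\<close> there. One such sequence
  is the Bernstein sequence \<open>b\<close>, since \<open>f\<close> is continuous on the whole unit interval; its limit \<open>S\<close> is
  the limit of all of them, and the only candidate.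
\<close>

lemma fun_calc_limit:
  assumes f: "continuous_on {0..1} f"
  shows "bounded_linear (fun_calc T f) \<and> (\<forall>p. uniform_limit (spectrum_op T) (\<lambda>n. poly (p n)) f sequentially \<longrightarrow>
      (\<lambda>n. onorm (\<lambda>x. poly_op (p n) T x - fun_calc T f x)) \<longlonglongrightarrow> 0)"
    (is "?P (fun_calc T f)")
proof -
  obtain b where b: "uniform_limit {0..1} (\<lambda>n. poly (b n)) f sequentially"
    using bernstein_polynomial_approx[OF f] by blast
  then have b_spec: "uniform_limit (spectrum_op T) (\<lambda>n. poly (b n)) f sequentially"
    using spectrum_subset uniform_limit_on_subset by blast
  have close: "\<forall>\<^sub>F n in sequentially. \<forall>\<^sub>F m in sequentially. \<forall>x. norm (poly_op (p n) T x - poly_op (b m) T x) \<le> e * norm x"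
    if p: "uniform_limit (spectrum_op T) (\<lambda>n. poly (p n)) f sequentially" and "e > 0" for p e
  proof -
    have "\<forall>\<^sub>F n in sequentially. \<forall>l\<in>spectrum_op T. dist (poly (p n) l) (f l) < e / 2"
      using uniform_limitD[OF p, of "e / 2"] \<open>e > 0\<close> by simp
    then show ?thesis
    proof eventually_elim
      case n: (elim n)
      have "\<forall>\<^sub>F m in sequentially. \<forall>l\<in>spectrum_op T. dist (poly (b m) l) (f l) < e / 2"
        using uniform_limitD[OF b_spec, of "e / 2"] \<open>e > 0\<close> by simp
      then show ?case
      proof eventually_elim
        case m: (elim m)
        show ?case
        proof
          fix x
          have "norm (poly_op (p n - b m) T x) \<le> e * norm x"
          proof (rule norm_poly_op_le_spectrum)
            fix l assume "l \<in> spectrum_op T"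
            then have "dist (poly (p n) l) (poly (b m) l) < e / 2 + e / 2"
              using n m by (intro dist_triangle_less_add[of _ "f l"]) (auto simp: dist_commute)
            then show "\<bar>poly (p n - b m) l\<bar> \<le> e" by (simp add: dist_real_def)
          qed (use \<open>e > 0\<close> in simp)
          then show "norm (poly_op (p n) T x - poly_op (b m) T x) \<le> e * norm x"
            by (simp add: poly_op_diff)
        qed
      qed
    qed
  qed
  define S where "S = (\<lambda>x. lim (\<lambda>n. poly_op (b n) T x))"
  have S: "(\<lambda>n. poly_op (b n) T x) \<longlonglongrightarrow> S x" for x
  proof -
    have "Cauchy (\<lambda>n. poly_op (b n) T x)"
    proof (rule metric_CauchyI)
      fix e :: real assume "e > 0"
      define e' where "e' = e / (2 * (norm x + 1))"
      have "e' > 0" unfolding e'_def using \<open>e > 0\<close> by (simp add: add_nonneg_pos)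
      have "2 * e' * norm x < e' * (2 * (norm x + 1))"
        using \<open>e' > 0\<close> by (simp add: algebra_simps)
      also have "norm x + 1 > 0" by (simp add: add_nonneg_pos)
      then have "e' * (2 * (norm x + 1)) = e" unfolding e'_def by simp
      finally have e': "2 * e' * norm x < e" .
      obtain n where "\<forall>\<^sub>F m in sequentially. \<forall>x. norm (poly_op (b n) T x - poly_op (b m) T x) \<le> e' * norm x"
        using eventually_happens[OF close[OF b_spec \<open>e' > 0\<close>]] by auto
      then obtain N where N: "\<And>m. m \<ge> N \<Longrightarrow> norm (poly_op (b n) T x - poly_op (b m) T x) \<le> e' * norm x"
        unfolding eventually_sequentially by blast
      have "dist (poly_op (b i) T x) (poly_op (b j) T x) < e" if "i \<ge> N" "j \<ge> N" for i j
        using N[OF that(1)] N[OF that(2)] e'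
          dist_triangle3[of "poly_op (b i) T x" "poly_op (b j) T x" "poly_op (b n) T x"]
        by (simp add: dist_norm)
      then show "\<exists>M. \<forall>i\<ge>M. \<forall>j\<ge>M. dist (poly_op (b i) T x) (poly_op (b j) T x) < e" by blast
    qed
    then show ?thesis unfolding S_def using Cauchy_convergent convergent_LIMSEQ_iff by blast
  qed
  have approx: "\<forall>\<^sub>F n in sequentially. \<forall>x. norm (poly_op (p n) T x - S x) \<le> e * norm x"
    if p: "uniform_limit (spectrum_op T) (\<lambda>n. poly (p n)) f sequentially" and "e > 0" for p e
    using close[OF that]
  proof eventually_elim
    case (elim n)
    show ?case
    proof
      fix x
      have "\<forall>\<^sub>F m in sequentially. norm (poly_op (p n) T x - poly_op (b m) T x) \<le> e * norm x"
        using elim by eventually_elim blast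
      then show "norm (poly_op (p n) T x - S x) \<le> e * norm x"
        by (intro tendsto_upperbound[OF tendsto_norm[OF tendsto_diff[OF tendsto_const S]]]) auto
    qed
  qed
  interpret B: bounded_linear "poly_op (b n) T" for n by (rule bounded_linear_poly)
  have bl: "bounded_linear S"
  proof -
    obtain n where n: "\<And>x. norm (poly_op (b n) T x - S x) \<le> 1 * norm x"
      using eventually_happens[OF approx[OF b_spec, of 1]] by auto
    obtain K where K: "\<And>x. norm (poly_op (b n) T x) \<le> norm x * K"
      using B.bounded[of n] by blast
    show ?thesis
    proof (rule bounded_linear_intro[where K = "K + 1"])
      show "S (x + y) = S x + S y" for x y
        using LIMSEQ_unique[OF S[of "x + y"]] tendsto_add[OF S[of x] S[of y]] by (simp add: B.add)
      show "S (r *\<^sub>R x) = r *\<^sub>R S x" for r x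
        using LIMSEQ_unique[OF S[of "r *\<^sub>R x"]] tendsto_scaleR[OF tendsto_const S[of x]] by (simp add: B.scaleR)
      show "norm (S x) \<le> norm x * (K + 1)" for x
        using norm_triangle_sub[of "S x" "poly_op (b n) T x"] n[of x] K[of x]
        by (simp add: norm_minus_commute algebra_simps)
    qed
  qed
  have conv: "(\<lambda>n. onorm (\<lambda>x. poly_op (p n) T x - S x)) \<longlonglongrightarrow> 0"
    if p: "uniform_limit (spectrum_op T) (\<lambda>n. poly (p n)) f sequentially" for p
  proof (rule tendstoI)
    fix e :: real assume "e > 0"
    then have "\<forall>\<^sub>F n in sequentially. \<forall>x. norm (poly_op (p n) T x - S x) \<le> e / 2 * norm x"
      by (intro approx[OF p]) auto
    then show "\<forall>\<^sub>F n in sequentially. dist (onorm (\<lambda>x. poly_op (p n) T x - S x)) 0 < e"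
    proof eventually_elim
      case (elim n)
      have "onorm (\<lambda>x. poly_op (p n) T x - S x) \<le> e / 2"
        using elim \<open>e > 0\<close> by (intro onorm_bound) auto
      moreover have "0 \<le> onorm (\<lambda>x. poly_op (p n) T x - S x)"
        by (intro onorm_pos_le bounded_linear_sub bounded_linear_poly bl)
      ultimately show ?case using \<open>e > 0\<close> by simp
    qed
  qed
  have ex: "?P S" using bl conv by blast
  have unique: "S' = S" if "?P S'" for S'
  proof
    fix x
    have S': "bounded_linear S'" "(\<lambda>n. onorm (\<lambda>x. poly_op (b n) T x - S' x)) \<longlonglongrightarrow> 0"
      using that b_spec by blast+
    have bound: "norm (poly_op (b n) T x - S' x) \<le> onorm (\<lambda>x. poly_op (b n) T x - S' x) * norm x" for n
      by (intro onorm bounded_linear_sub bounded_linear_poly S')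
    have "(\<lambda>n. poly_op (b n) T x - S' x) \<longlonglongrightarrow> 0"
      by (rule Lim_null_comparison[OF always_eventually[OF allI[OF bound]]])
        (use tendsto_mult_left_zero[OF S'(2)] in blast)
    then have "(\<lambda>n. poly_op (b n) T x) \<longlonglongrightarrow> S' x"
      by (simp add: LIM_zero_iff)
    then show "S' x = S x" using LIMSEQ_unique S by blast
  qed
  show ?thesis
    unfolding fun_calc_def by (rule theI[where P = ?P, OF ex]) (rule unique)
qed

text \<open>
  The product \<open>p(T) f(T)\<close> is the limit of \<open>(p b\<^sub>n)(T)\<close> for polynomials \<open>b\<^sub>n\<close> approximating \<open>f\<close>, so
  the norm bound for polynomials carries over.
\<close>

lemma norm_poly_op_fun_calc_le:
  assumes f: "continuous_on {0..1} f"
    and bound: "\<And>t. t \<in> {0..1} \<Longrightarrow> \<bar>poly p t * f t\<bar> \<le> M"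
  shows "norm (poly_op p T (fun_calc T f x)) \<le> M * norm x"
proof -
  let ?S = "fun_calc T f"
  obtain b where b: "uniform_limit {0..1} (\<lambda>n. poly (b n)) f sequentially"
    using bernstein_polynomial_approx[OF f] by blast
  then have "uniform_limit (spectrum_op T) (\<lambda>n. poly (b n)) f sequentially"
    using spectrum_subset uniform_limit_on_subset by blast
  then have lim: "(\<lambda>n. onorm (\<lambda>x. poly_op (b n) T x - ?S x)) \<longlonglongrightarrow> 0" and S: "bounded_linear ?S"
    using fun_calc_limit[OF f] by blast+
  have bnd: "norm (poly_op (b n) T x - ?S x) \<le> onorm (\<lambda>x. poly_op (b n) T x - ?S x) * norm x" for n
    by (intro onorm bounded_linear_sub bounded_linear_poly S)
  have "(\<lambda>n. poly_op (b n) T x - ?S x) \<longlonglongrightarrow> 0"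
    by (rule Lim_null_comparison[OF always_eventually[OF allI[OF bnd]]])
      (use tendsto_mult_left_zero[OF lim] in blast)
  then have "(\<lambda>n. poly_op (b n) T x) \<longlonglongrightarrow> ?S x"
    by (simp add: LIM_zero_iff)
  then have lim': "(\<lambda>n. poly_op p T (poly_op (b n) T x)) \<longlonglongrightarrow> poly_op p T (?S x)"
    by (rule bounded_linear.tendsto[OF bounded_linear_poly])
  have "norm (poly_op p T (?S x)) \<le> (M + e) * norm x" if "e > 0" for e
  proof -
    have "bounded (poly p ` {0..1})"
      by (intro compact_imp_bounded compact_continuous_image continuous_intros) auto
    then obtain K where K: "K > 0" "\<And>t. t \<in> {0..1} \<Longrightarrow> \<bar>poly p t\<bar> \<le> K"
      unfolding bounded_pos by auto
    have "\<forall>\<^sub>F n in sequentially. \<forall>t\<in>{0..1}. dist (poly (b n) t) (f t) < e / K"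
      using uniform_limitD[OF b, of "e / K"] \<open>e > 0\<close> K(1) by simp
    then have "\<forall>\<^sub>F n in sequentially. norm (poly_op p T (poly_op (b n) T x)) \<le> (M + e) * norm x"
    proof eventually_elim
      case (elim n)
      have "norm (poly_op (p * b n) T x) \<le> (M + e) * norm x"
      proof (rule norm_poly_op_le_unit_interval)
        fix t :: real assume t: "t \<in> {0..1}"
        have "\<bar>poly p t * (poly (b n) t - f t)\<bar> \<le> K * (e / K)"
          unfolding abs_mult using elim t K
          by (intro mult_mono) (auto simp: dist_real_def less_imp_le)
        then show "\<bar>poly (p * b n) t\<bar> \<le> M + e"
          using bound[OF t] K(1) by (simp add: algebra_simps)
      qed
      then show ?case by (simp add: poly_op_mult[OF bounded_linear_T])
    qed
    then show ?thesis
      by (intro tendsto_upperbound[OF tendsto_norm[OF lim']]) auto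
  qed
  then have "\<forall>\<^sub>F e in at_right 0. norm (poly_op p T (?S x)) \<le> (M + e) * norm x"
    by (auto simp: eventually_at_right_field intro!: exI[of _ 1])
  moreover have "((\<lambda>e. (M + e) * norm x) \<longlongrightarrow> M * norm x) (at_right 0)"
    by (auto intro!: tendsto_eq_intros)
  ultimately show ?thesis
    by (intro tendsto_lowerbound) auto
qed

end

section \<open>Asymptotics of the weighted Gegenbauer recurrence\<close>

text \<open>
  The logarithm of \<open>(m - \<nu>) / (m + \<nu>)\<close> is odd in \<open>1 / m\<close>, so the error after the linear term is
  cubic. Taking this once for \<open>\<nu>\<close> and once for 1 cancels the linear terms in the damping factor
  below; this is why the weights are centred at \<open>n + \<nu>\<close>.
\<close>

lemma log_ratio_bigo:
  fixes \<nu> :: real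
  assumes "\<nu> > 0"
  shows "(\<lambda>m. ln ((m - \<nu>) / (m + \<nu>)) + 2 * \<nu> / m) \<in> O[at_top](\<lambda>m. 1 / m ^ 3)"
  using assms by real_asymp

lemma bigo_imp_tendsto_0:
  fixes f g :: "'a \<Rightarrow> real"
  assumes "f \<in> O[F](g)" "(g \<longlongrightarrow> 0) F"
  shows "(f \<longlongrightarrow> 0) F"
proof -
  obtain c where "eventually (\<lambda>x. norm (f x) \<le> c * norm (g x)) F"
    using assms(1) by (auto elim!: landau_o.bigE)
  moreover have "((\<lambda>x. c * norm (g x)) \<longlongrightarrow> 0) F"
    using tendsto_mult_right_zero[OF tendsto_norm_zero[OF assms(2)]] by simp
  ultimately show ?thesis
    by (rule Lim_null_comparison)
qed

lemma damping_deviation_bigo: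
  fixes \<nu> :: real
  assumes "\<nu> > 0"
  shows "(\<lambda>m. (m - \<nu>) / (m + \<nu>) * ((m + 1) / (m - 1)) powr \<nu> - 1) \<in> O[at_top](\<lambda>m. 1 / m ^ 3)"
proof -
  define f where "f = (\<lambda>m. (ln ((m - \<nu>) / (m + \<nu>)) + 2 * \<nu> / m)
      - \<nu> * (ln ((m - 1) / (m + 1)) + 2 * 1 / m))"
  have f: "f \<in> O[at_top](\<lambda>m. 1 / m ^ 3)"
    unfolding f_def using log_ratio_bigo[OF assms] log_ratio_bigo[of 1]
    by (intro sum_in_bigo(2)) auto
  have "((\<lambda>m::real. 1 / m ^ 3) \<longlongrightarrow> 0) at_top"
    by real_asymp
  with f have f0: "(f \<longlongrightarrow> 0) at_top"
    by (rule bigo_imp_tendsto_0)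
  have "((\<lambda>x::real. (exp x - 1) / x) \<longlongrightarrow> 1) (at 0)"
    by real_asymp
  then have "eventually (\<lambda>x::real. \<bar>(exp x - 1) / x\<bar> < 2) (at 0)"
    by (intro order_tendstoD(2)[OF tendsto_rabs]) auto
  then have "eventually (\<lambda>x::real. \<bar>exp x - 1\<bar> \<le> 2 * \<bar>x\<bar>) (nhds 0)"
    unfolding eventually_at_filter by eventually_elim (auto simp: field_simps abs_divide split: if_splits)
  then have "eventually (\<lambda>m. \<bar>exp (f m) - 1\<bar> \<le> 2 * \<bar>f m\<bar>) at_top"
    using f0 by (rule eventually_compose_filterlim)
  then have "(\<lambda>m. exp (f m) - 1) \<in> O[at_top](f)"
    by (intro landau_o.bigI[of 2]) auto
  then have "(\<lambda>m. exp (f m) - 1) \<in> O[at_top](\<lambda>m. 1 / m ^ 3)"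
    using f by (rule landau_o.big_trans)
  moreover have "eventually (\<lambda>m. exp (f m) - 1 = (m - \<nu>) / (m + \<nu>) * ((m + 1) / (m - 1)) powr \<nu> - 1) at_top"
    using eventually_gt_at_top[of "max 1 \<nu>"]
  proof eventually_elim
    case (elim m)
    have "ln ((m - 1) / (m + 1)) = - ln ((m + 1) / (m - 1))"
      using elim by (simp add: ln_div)
    then have "f m = ln ((m - \<nu>) / (m + \<nu>)) + \<nu> * ln ((m + 1) / (m - 1))"
      unfolding f_def by (simp add: algebra_simps)
    then show ?case
      using elim assms by (simp add: exp_add powr_def)
  qed
  ultimately show ?thesis
    by (simp add: landau_o.big.in_cong)
qed

text \<open>
  The derivative of the logarithm of the coupling \<open>m / (m + \<nu>) * ((m + 1) / m) powr \<nu>\<close> is the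
  rational function \<open>\<nu> (1 - \<nu>) / (m (m + 1) (m + \<nu>))\<close>, which is of cubic decay.
\<close>

lemma log_coupling_increment_le:
  fixes \<nu> m :: real
  assumes "\<nu> > 0" "m > 0"
  shows "\<bar>(\<nu> * ln ((m + 2) / (m + 1)) - ln ((m + 1 + \<nu>) / (m + 1)))
          - (\<nu> * ln ((m + 1) / m) - ln ((m + \<nu>) / m))\<bar> \<le> \<nu> * \<bar>1 - \<nu>\<bar> / m ^ 3"
proof -
  define h where "h = (\<lambda>x. (\<nu> * ln ((x + 1) / x) - ln ((x + \<nu>) / x)))"
  define h' where "h' = (\<lambda>x::real. \<nu> * (1 - \<nu>) / (x * (x + 1) * (x + \<nu>)))"
  have d: "(h has_real_derivative h' x) (at x)" if "x > 0" for x
  proof -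
    have "(h has_real_derivative (\<nu> * ((1 * x - (x + 1) * 1) / (x * x) / ((x + 1) / x)) - (1 * x - (x + \<nu>) * 1) / (x * x) / ((x + \<nu>) / x))) (at x)"
      unfolding h_def using that assms
      by (auto intro!: derivative_eq_intros simp: mult.commute)
    also have "\<nu> * ((1 * x - (x + 1) * 1) / (x * x) / ((x + 1) / x)) - (1 * x - (x + \<nu>) * 1) / (x * x) / ((x + \<nu>) / x)
        = \<nu> / ((x + \<nu>) * x) - \<nu> / ((x + 1) * x)"
      using that assms by (simp add: mult.commute)
    also have "\<dots> = h' x"
      unfolding h'_def using that assms by (simp add: divide_simps) (simp add: algebra_simps)
    finally show ?thesis .
  qed
  obtain z where z: "m < z" "z < m + 1" "h (m + 1) - h m = (m + 1 - m) * h' z"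
    using MVT2[of m "m + 1" h h'] d assms by auto
  have "m ^ 3 \<le> z * (z + 1) * (z + \<nu>)"
    unfolding power3_eq_cube using z assms by (intro mult_mono) auto
  then have "\<bar>h' z\<bar> \<le> \<nu> * \<bar>1 - \<nu>\<bar> / m ^ 3"
    unfolding h'_def using z assms by (auto simp: abs_mult intro!: divide_left_mono)
  moreover have "m + 1 + 1 = m + 2" by simp
  ultimately show ?thesis using z unfolding h_def by (metis (no_types, lifting) add_diff_cancel_left' lambda_one)
qed

section \<open>Decay of the normalised Gegenbauer polynomials\<close>

text \<open>
  The Gegenbauer polynomial \<open>C\<^sub>n\<^sup>\<nu>(s)\<close> divided by its value at \<open>s = 1\<close>. The recurrence is in the
  momentum form \<open>q'' = s q' + a (s q' - q)\<close> with \<open>a \<le> 1\<close>, which makes the energy estimate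
  below visible.
\<close>

fun gegenbauer :: "real \<Rightarrow> real \<Rightarrow> nat \<Rightarrow> real" where
  "gegenbauer \<nu> s 0 = 1"
| "gegenbauer \<nu> s (Suc 0) = s"
| "gegenbauer \<nu> s (Suc (Suc n)) =
     (let a = (real n + 1) / (real n + 1 + 2 * \<nu>)
      in (1 + a) * s * gegenbauer \<nu> s (Suc n) - a * gegenbauer \<nu> s n)"

text \<open>
  The left-hand side is the energy \<open>q'\<^sup>2 - 2 s q' q + q\<^sup>2\<close> of two consecutive values. It is symmetric
  in them, and \<open>q'' - s q' = a (s q' - q)\<close> with \<open>a \<le> 1\<close>, so it does not increase with the index.
\<close>

lemma gegenbauer_energy_le:
  assumes "\<nu> \<ge> 0"
  shows "(gegenbauer \<nu> s (Suc n) - s * gegenbauer \<nu> s n) ^ 2 + (1 - s ^ 2) * gegenbauer \<nu> s n ^ 2 \<le> 1 - s ^ 2"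
proof (induction n)
  case (Suc n)
  define a where "a = (real n + 1) / (real n + 1 + 2 * \<nu>)"
  let ?q = "gegenbauer \<nu> s n" and ?q' = "gegenbauer \<nu> s (Suc n)"
  have "0 \<le> a" "a \<le> 1" unfolding a_def using assms by auto
  then have a: "a ^ 2 \<le> 1" by (simp add: power_le_one)
  have "gegenbauer \<nu> s (Suc (Suc n)) = (1 + a) * s * ?q' - a * ?q"
    by (simp add: Let_def a_def)
  then have "gegenbauer \<nu> s (Suc (Suc n)) - s * ?q' = a * (s * ?q' - ?q)"
    by (simp add: algebra_simps del: gegenbauer.simps)
  then have "(gegenbauer \<nu> s (Suc (Suc n)) - s * ?q') ^ 2 = a ^ 2 * (s * ?q' - ?q) ^ 2"
    by (simp add: power_mult_distrib)
  also have "\<dots> \<le> (s * ?q' - ?q) ^ 2"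
    using mult_right_mono[OF a, of "(s * ?q' - ?q) ^ 2"] by simp
  finally have "(gegenbauer \<nu> s (Suc (Suc n)) - s * ?q') ^ 2 + (1 - s ^ 2) * ?q' ^ 2
      \<le> (?q' - s * ?q) ^ 2 + (1 - s ^ 2) * ?q ^ 2"
    by (simp add: power2_eq_square algebra_simps)
  with Suc show ?case by linarith
qed simp

lemma abs_gegenbauer_le_1:
  assumes "\<nu> \<ge> 0" "\<bar>s\<bar> \<le> 1"
  shows "\<bar>gegenbauer \<nu> s n\<bar> \<le> 1"
proof (cases "s ^ 2 = 1")
  case True
  then have "gegenbauer \<nu> s (Suc n) = s * gegenbauer \<nu> s n" for n
    using gegenbauer_energy_le[OF assms(1), of s n] by simp
  then have "gegenbauer \<nu> s n = s ^ n"
    by (induction n) auto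
  then show ?thesis
    using assms(2) by (simp add: power_abs power_le_one)
next
  case False
  then have "1 - s ^ 2 > 0"
    using assms(2) by (simp add: abs_square_le_1 less_le)
  moreover have "(1 - s ^ 2) * gegenbauer \<nu> s n ^ 2 \<le> 1 - s ^ 2"
    using gegenbauer_energy_le[OF assms(1), of s n] zero_le_power2[of "gegenbauer \<nu> s (Suc n) - s * gegenbauer \<nu> s n"]
    by linarith
  ultimately have "gegenbauer \<nu> s n ^ 2 \<le> 1" by simp
  then show ?thesis by (simp add: abs_square_le_1)
qed

text \<open>
  The factors multiply up to at most the exponential of a tail of a cubic series, and
  \<open>1 / (n + 1)\<^sup>3 \<le> 1 / n\<^sup>2 - 1 / (n + 1)\<^sup>2\<close> telescopes: \<open>F n * exp (D / n\<^sup>2)\<close> is nonincreasing.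
\<close>

lemma discrete_gronwall_cubic:
  fixes F :: "nat \<Rightarrow> real"
  assumes "K \<ge> 1" "D \<ge> 0" "\<And>n. n \<ge> K \<Longrightarrow> 0 \<le> F n"
    and step: "\<And>n. n \<ge> K \<Longrightarrow> F (Suc n) \<le> F n * (1 + D / real (Suc n) ^ 3)"
    and "n \<ge> K"
  shows "F n \<le> F K * exp (D / real K ^ 2)"
proof -
  have "F n * exp (D / real n ^ 2) \<le> F K * exp (D / real K ^ 2)"
    using \<open>n \<ge> K\<close>
  proof (induction n rule: dec_induct)
    case (step n)
    then have n: "real n > 0" using assms(1) by simp
    define N where "N = real n"
    have "N > 0" using n N_def by simp
    have "1 / (N + 1) ^ 3 + 1 / (N + 1) ^ 2 \<le> 1 / N ^ 2"
    proof -
      have "1 / M ^ 3 + 1 / M ^ 2 = (M + 1) / M ^ 3" if "M > 0" for M :: real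
        using that by (simp add: field_simps power2_eq_square power3_eq_cube)
      from this[of "N + 1"] have "1 / (N + 1) ^ 3 + 1 / (N + 1) ^ 2 = (N + 2) / (N + 1) ^ 3"
        using \<open>N > 0\<close> by simp
      also have "(N + 2) * N ^ 2 \<le> (N + 1) ^ 3"
        using \<open>N > 0\<close> by (simp add: power2_eq_square power3_eq_cube algebra_simps)
      then have "(N + 2) / (N + 1) ^ 3 \<le> 1 / N ^ 2"
        using \<open>N > 0\<close> by (subst frac_le_eq) (auto simp: divide_le_0_iff mult.commute)
      finally show ?thesis .
    qed
    then have "D * (1 / (N + 1) ^ 3 + 1 / (N + 1) ^ 2) \<le> D * (1 / N ^ 2)"
      using assms(2) by (rule mult_left_mono)
    then have cmp: "D / real (Suc n) ^ 3 + D / real (Suc n) ^ 2 \<le> D / real n ^ 2"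
      by (simp add: N_def algebra_simps)
    have "F (Suc n) * exp (D / real (Suc n) ^ 2)
        \<le> F n * (1 + D / real (Suc n) ^ 3) * exp (D / real (Suc n) ^ 2)"
      using assms(4)[of n] step by (intro mult_right_mono) auto
    also have "\<dots> \<le> F n * exp (D / real (Suc n) ^ 3) * exp (D / real (Suc n) ^ 2)"
      using assms(3)[of n] step by (intro mult_right_mono mult_left_mono exp_ge_add_one_self) auto
    also have "\<dots> \<le> F n * exp (D / real n ^ 2)"
      using assms(3)[of n] step cmp by (simp add: mult.assoc flip: exp_add) (intro mult_left_mono, auto)
    finally show ?case using step by linarith
  qed simp
  moreover have "F n * 1 \<le> F n * exp (D / real n ^ 2)"
    using assms by (intro mult_left_mono) auto
  ultimately show ?thesis by linarith
qed

text \<open>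
  For \<open>g = 1\<close> and \<open>b' = b\<close> the quadratic form \<open>v\<^sub>1\<^sup>2 - 2 s b v\<^sub>1 v\<^sub>0 + v\<^sub>0\<^sup>2\<close> is invariant under
  \<open>v\<^sub>2 + v\<^sub>0 = 2 s b v\<^sub>1\<close>. This quantifies the effect of perturbing both.
\<close>

lemma recurrence_energy_step:
  fixes v0 v1 v2 :: real
  assumes "v2 + g * v0 = 2 * s * b * v1" and "\<bar>g - 1\<bar> \<le> \<epsilon>" "\<bar>b' - b\<bar> \<le> \<epsilon>"
    and "\<bar>b\<bar> \<le> 2" "\<bar>g\<bar> \<le> 2" "0 \<le> s" "s \<le> 1"
  shows "v2 ^ 2 - 2 * s * b' * v2 * v1 + v1 ^ 2
      \<le> v1 ^ 2 - 2 * s * b * v1 * v0 + v0 ^ 2 + 15 * \<epsilon> * (v0 ^ 2 + v1 ^ 2)"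
proof -
  have v2: "v2 = 2 * s * b * v1 - g * v0" using assms(1) by simp
  have amgm: "2 * \<bar>v0 * v1\<bar> \<le> v0 ^ 2 + v1 ^ 2"
    using sum_squares_bound[of "\<bar>v0\<bar>" "\<bar>v1\<bar>"] by (simp add: abs_mult)
  have "\<epsilon> \<ge> 0" using assms(2) by linarith
  have id: "v2 ^ 2 - 2 * s * b' * v2 * v1 + v1 ^ 2 - (v1 ^ 2 - 2 * s * b * v1 * v0 + v0 ^ 2)
      = (g - 1) * ((g + 1) * v0 ^ 2) - (g - 1) * (2 * (s * (b * (v0 * v1)))) - (b' - b) * (2 * (s * (v2 * v1)))"
    unfolding v2 by (simp add: power2_eq_square algebra_simps)
  have "\<bar>(g - 1) * ((g + 1) * v0 ^ 2)\<bar> \<le> \<epsilon> * (3 * v0 ^ 2)"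
    unfolding abs_mult using assms by (intro mult_mono) auto
  moreover have "\<bar>(g - 1) * (2 * (s * (b * (v0 * v1))))\<bar> \<le> \<epsilon> * (2 * (1 * (2 * \<bar>v0 * v1\<bar>)))"
    unfolding abs_mult using assms by (intro mult_mono) auto
  moreover have "\<bar>(b' - b) * (2 * (s * (v2 * v1)))\<bar> \<le> \<epsilon> * (2 * (1 * ((4 * \<bar>v1\<bar> + 2 * \<bar>v0\<bar>) * \<bar>v1\<bar>)))"
  proof -
    have "\<bar>v2\<bar> \<le> \<bar>2 * (s * (b * v1))\<bar> + \<bar>g * v0\<bar>" unfolding v2 by (simp add: mult.assoc)
    also have "\<bar>2 * (s * (b * v1))\<bar> \<le> 2 * (1 * (2 * \<bar>v1\<bar>))"
      unfolding abs_mult using assms by (intro mult_mono) auto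
    also have "\<bar>g * v0\<bar> \<le> 2 * \<bar>v0\<bar>"
      unfolding abs_mult using assms by (intro mult_mono) auto
    finally have "\<bar>v2\<bar> \<le> 4 * \<bar>v1\<bar> + 2 * \<bar>v0\<bar>" by simp
    then show ?thesis
      unfolding abs_mult using assms by (intro mult_mono) auto
  qed
  ultimately have "v2 ^ 2 - 2 * s * b' * v2 * v1 + v1 ^ 2 - (v1 ^ 2 - 2 * s * b * v1 * v0 + v0 ^ 2)
      \<le> \<epsilon> * (3 * v0 ^ 2) + \<epsilon> * (2 * (1 * (2 * \<bar>v0 * v1\<bar>))) + \<epsilon> * (2 * (1 * ((4 * \<bar>v1\<bar> + 2 * \<bar>v0\<bar>) * \<bar>v1\<bar>)))"
    unfolding id by linarith
  also have "\<dots> = \<epsilon> * (3 * v0 ^ 2 + 8 * v1 ^ 2 + 4 * (2 * \<bar>v0 * v1\<bar>))"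
    by (simp add: algebra_simps abs_mult power2_eq_square)
  also have "\<dots> \<le> \<epsilon> * (3 * v0 ^ 2 + 8 * v1 ^ 2 + 4 * (v0 ^ 2 + v1 ^ 2))"
    using amgm \<open>\<epsilon> \<ge> 0\<close> by (intro mult_left_mono) auto
  also have "\<dots> \<le> \<epsilon> * (15 * (v0 ^ 2 + v1 ^ 2))"
    using \<open>\<epsilon> \<ge> 0\<close> by (intro mult_left_mono) auto
  also have "\<dots> = 15 * \<epsilon> * (v0 ^ 2 + v1 ^ 2)" by simp
  finally show ?thesis by linarith
qed

text \<open>
  The coefficients of the recurrence satisfied by \<open>(n + \<nu>) powr \<nu> * q\<^sub>n\<close>, at the position
  \<open>m = n + 1 + \<nu>\<close> of the middle one of the three terms.
\<close>

definition coupling :: "real \<Rightarrow> real \<Rightarrow> real" where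
  "coupling \<nu> m = m / (m + \<nu>) * ((m + 1) / m) powr \<nu>"

definition damping :: "real \<Rightarrow> real \<Rightarrow> real" where
  "damping \<nu> m = (m - \<nu>) / (m + \<nu>) * ((m + 1) / (m - 1)) powr \<nu>"

lemma abs_exp_diff_le:
  fixes x y :: real
  shows "\<bar>exp x - exp y\<bar> \<le> max (exp x) (exp y) * \<bar>x - y\<bar>"
proof -
  have "exp x - exp y \<le> exp x * (x - y)" for x y :: real
  proof -
    have "exp x * (1 + (y - x)) \<le> exp x * exp (y - x)"
      by (intro mult_left_mono exp_ge_add_one_self) auto
    then show ?thesis by (simp add: algebra_simps flip: exp_add)
  qed
  then have *: "exp x - exp y \<le> max (exp x) (exp y) * (x - y)" if "y \<le> x" for x y :: real
    using that by (simp add: max_def)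
  show ?thesis
    using *[of x y] *[of y x] by (cases "y \<le> x") (auto simp: max.commute abs_if)
qed

text \<open>
  The last bound compares the weights at two neighbouring indices; it enters only through the initial
  energy.
\<close>

lemma recurrence_coefficient_bounds:
  assumes "\<nu> > 0"
  obtains C M0 where "C \<ge> 1" "M0 \<ge> 1"
    "\<And>m. m \<ge> M0 \<Longrightarrow> \<bar>coupling \<nu> m - 1\<bar> \<le> C / m ^ 2"
    "\<And>m. m \<ge> M0 \<Longrightarrow> \<bar>coupling \<nu> (m + 1) - coupling \<nu> m\<bar> \<le> C / m ^ 3"
    "\<And>m. m \<ge> M0 \<Longrightarrow> \<bar>damping \<nu> m - 1\<bar> \<le> C / m ^ 3"
    "\<And>m. m \<ge> M0 \<Longrightarrow> \<bar>((m - 1) / m) powr \<nu> - 1\<bar> \<le> C / m"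
proof -
  have 1: "(\<lambda>m. coupling \<nu> m - 1) \<in> O[at_top](\<lambda>m. 1 / m ^ 2)"
    unfolding coupling_def using assms by real_asymp
  have 2: "(\<lambda>m. damping \<nu> m - 1) \<in> O[at_top](\<lambda>m. 1 / m ^ 3)"
    unfolding damping_def by (rule damping_deviation_bigo[OF assms])
  have 3: "(\<lambda>m. ((m - 1) / m) powr \<nu> - 1) \<in> O[at_top](\<lambda>m::real. 1 / m)"
    using assms by real_asymp
  have lim: "(coupling \<nu> \<longlongrightarrow> 1) at_top"
    unfolding coupling_def using assms by real_asymp
  then have lt: "\<forall>\<^sub>F m in at_top. coupling \<nu> m < 2" by (rule order_tendstoD) simp
  then have lt': "\<forall>\<^sub>F m in at_top. coupling \<nu> (m + 1) < 2"
    by (rule eventually_compose_filterlim) real_asymp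
  have 4: "(\<lambda>m. coupling \<nu> (m + 1) - coupling \<nu> m) \<in> O[at_top](\<lambda>m. 1 / m ^ 3)"
  proof (rule landau_o.bigI)
    show "\<forall>\<^sub>F m in at_top. norm (coupling \<nu> (m + 1) - coupling \<nu> m) \<le> (2 * (\<nu> * \<bar>1 - \<nu>\<bar>) + 1) * norm (1 / m ^ 3)"
      using eventually_gt_at_top[of 0] lt lt'
    proof eventually_elim
      case (elim m)
      define h where "h = (\<lambda>m. \<nu> * ln ((m + 1) / m) - ln ((m + \<nu>) / m))"
      have h: "coupling \<nu> x = exp (h x)" if "x > 0" for x
      proof -
        have "(x + 1) / x > 0" "(x + \<nu>) / x > 0" using that assms by auto
        then have "exp (h x) = ((x + 1) / x) powr \<nu> / ((x + \<nu>) / x)"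
          unfolding h_def exp_diff by (subst exp_ln) (auto simp: powr_def)
        then show ?thesis by (simp add: coupling_def mult.commute)
      qed
      have "\<bar>coupling \<nu> (m + 1) - coupling \<nu> m\<bar> \<le> 2 * \<bar>h (m + 1) - h m\<bar>"
      proof -
        have "max (exp (h (m + 1))) (exp (h m)) \<le> 2"
          using elim h[of m] h[of "m + 1"] by simp
        then have "max (exp (h (m + 1))) (exp (h m)) * \<bar>h (m + 1) - h m\<bar> \<le> 2 * \<bar>h (m + 1) - h m\<bar>"
          by (rule mult_right_mono) simp
        then show ?thesis
          using abs_exp_diff_le[of "h (m + 1)" "h m"] elim h[of m] h[of "m + 1"] by simp
      qed
      also have "\<bar>h (m + 1) - h m\<bar> \<le> \<nu> * \<bar>1 - \<nu>\<bar> / m ^ 3"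
        using log_coupling_increment_le[of \<nu> m] elim assms by (simp add: h_def add.assoc)
      also have "2 * (\<nu> * \<bar>1 - \<nu>\<bar> / m ^ 3) \<le> (2 * (\<nu> * \<bar>1 - \<nu>\<bar>) + 1) / m ^ 3"
        using elim by (simp add: divide_simps)
      finally show ?case using elim by simp
    qed
  qed (use assms in \<open>simp add: add_nonneg_pos\<close>)
  obtain c1 c2 c3 c4 where c: "\<forall>\<^sub>F m in at_top. \<bar>coupling \<nu> m - 1\<bar> \<le> c1 * norm (1 / m ^ 2)"
    "\<forall>\<^sub>F m in at_top. \<bar>damping \<nu> m - 1\<bar> \<le> c2 * norm (1 / m ^ 3)"
    "\<forall>\<^sub>F m in at_top. \<bar>((m - 1) / m) powr \<nu> - 1\<bar> \<le> c3 * norm (1 / m)"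
    "\<forall>\<^sub>F m in at_top. \<bar>coupling \<nu> (m + 1) - coupling \<nu> m\<bar> \<le> c4 * norm (1 / m ^ 3)"
    using 1 2 3 4 by (auto elim!: landau_o.bigE)
  define C where "C = Max {1, c1, c2, c3, c4}"
  have C: "1 \<le> C" "c1 \<le> C" "c2 \<le> C" "c3 \<le> C" "c4 \<le> C"
    unfolding C_def by auto
  have weaken: "x \<le> C / m ^ j" if "x \<le> c' * norm (1 / m ^ j)" "c' \<le> C" "m > 0" for x c' m :: real and j :: nat
  proof -
    have "c' * norm (1 / m ^ j) \<le> C * norm (1 / m ^ j)"
      using that by (intro mult_right_mono) auto
    also have "\<dots> = C / m ^ j" using that by simp
    finally show ?thesis using that(1) by linarith
  qed
  have "\<forall>\<^sub>F m in at_top. \<bar>coupling \<nu> m - 1\<bar> \<le> C / m ^ 2 \<and> \<bar>coupling \<nu> (m + 1) - coupling \<nu> m\<bar> \<le> C / m ^ 3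
      \<and> \<bar>damping \<nu> m - 1\<bar> \<le> C / m ^ 3 \<and> \<bar>((m - 1) / m) powr \<nu> - 1\<bar> \<le> C / m"
    using c eventually_gt_at_top[of 0]
  proof eventually_elim
    case (elim m)
    then show ?case
      using weaken[of _ c1 m 2] weaken[of _ c2 m 3] weaken[of _ c3 m 1] weaken[of _ c4 m 3] C by auto
  qed
  then obtain M0 where "\<And>m. m \<ge> M0 \<Longrightarrow> \<bar>coupling \<nu> m - 1\<bar> \<le> C / m ^ 2 \<and> \<bar>coupling \<nu> (m + 1) - coupling \<nu> m\<bar> \<le> C / m ^ 3
      \<and> \<bar>damping \<nu> m - 1\<bar> \<le> C / m ^ 3 \<and> \<bar>((m - 1) / m) powr \<nu> - 1\<bar> \<le> C / m"
    unfolding eventually_at_top_linorder by blast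
  then show thesis using that[of C "max 1 M0"] C(1) by simp
qed

lemma weighted_gegenbauer_recurrence:
  fixes \<nu> s :: real
  assumes "\<nu> > 0"
  defines "v \<equiv> \<lambda>n. (real n + \<nu>) powr \<nu> * gegenbauer \<nu> s n"
  shows "v (Suc (Suc n)) + damping \<nu> (real n + 1 + \<nu>) * v n
      = 2 * s * coupling \<nu> (real n + 1 + \<nu>) * v (Suc n)"
proof -
  define m where "m = real n + 1 + \<nu>"
  have m: "m > 0" "m - 1 > 0" "m + \<nu> > 0" unfolding m_def using assms by auto
  have idx: "real n + \<nu> = m - 1" "real (Suc n) + \<nu> = m" "real (Suc (Suc n)) + \<nu> = m + 1"
    unfolding m_def by auto
  define a where "a = (m - \<nu>) / (m + \<nu>)"
  have rec: "gegenbauer \<nu> s (Suc (Suc n)) = (1 + a) * s * gegenbauer \<nu> s (Suc n) - a * gegenbauer \<nu> s n"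
    by (simp add: Let_def a_def m_def add.assoc)
  have 1: "damping \<nu> m * (m - 1) powr \<nu> = a * (m + 1) powr \<nu>"
    using m by (simp add: damping_def a_def powr_divide)
  have "1 + a = 2 * (m / (m + \<nu>))"
    unfolding a_def using m by (simp add: field_simps)
  then have 2: "2 * coupling \<nu> m * m powr \<nu> = (1 + a) * (m + 1) powr \<nu>"
    using m by (simp add: coupling_def powr_divide)
  have "v (Suc (Suc n)) + damping \<nu> m * v n = (m + 1) powr \<nu> * gegenbauer \<nu> s (Suc (Suc n))
      + (damping \<nu> m * (m - 1) powr \<nu>) * gegenbauer \<nu> s n"
    unfolding v_def idx by simp
  also have "\<dots> = s * ((1 + a) * (m + 1) powr \<nu>) * gegenbauer \<nu> s (Suc n)"
    unfolding rec 1 by (simp add: algebra_simps)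
  also have "\<dots> = 2 * s * coupling \<nu> m * v (Suc n)"
    unfolding v_def idx 2[symmetric] by simp
  finally show ?thesis unfolding m_def .
qed

text \<open>
  Put \<open>\<kappa> = 1 - s\<^sup>2\<close>. Below the threshold \<open>K \<approx> P / sqrt \<kappa>\<close> the claim follows from
  \<open>\<bar>q\<bar> \<le> 1\<close>. From \<open>K\<close> on, with the constant \<open>P\<close> large enough, the energy \<open>F\<close> of the weighted values
  \<open>v\<close> dominates \<open>\<kappa> / 4\<close> times their squares, so the cubic perturbations amount to relative errors
  \<open>60 C / (\<kappa> n\<^sup>3)\<close>, and their sum over \<open>n \<ge> K\<close> is bounded independently of \<open>s\<close> since \<open>\<kappa> K\<^sup>2 \<ge> 1\<close>.
  The initial energy \<open>F K\<close> is of size \<open>\<kappa>\<close> times the squared weight by the unweighted energy estimate. The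
  factors \<open>\<kappa>\<close> cancel, and the weight at \<open>K\<close> is of size \<open>\<kappa> powr (- \<nu> / 2)\<close>.
\<close>

lemma gegenbauer_decay:
  assumes "\<nu> > 0"
  obtains C where "C > 0"
    "\<And>s n. 0 \<le> s \<Longrightarrow> s < 1 \<Longrightarrow> \<bar>gegenbauer \<nu> s n\<bar> * ((real n + \<nu>) * sqrt (1 - s ^ 2)) powr \<nu> \<le> C"
proof -
  obtain C M0 where C: "C \<ge> 1" and M0: "M0 \<ge> 1"
    and b1: "\<And>m. m \<ge> M0 \<Longrightarrow> \<bar>coupling \<nu> m - 1\<bar> \<le> C / m ^ 2"
    and b2: "\<And>m. m \<ge> M0 \<Longrightarrow> \<bar>coupling \<nu> (m + 1) - coupling \<nu> m\<bar> \<le> C / m ^ 3"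
    and g1: "\<And>m. m \<ge> M0 \<Longrightarrow> \<bar>damping \<nu> m - 1\<bar> \<le> C / m ^ 3"
    and r1: "\<And>m. m \<ge> M0 \<Longrightarrow> \<bar>((m - 1) / m) powr \<nu> - 1\<bar> \<le> C / m"
    using recurrence_coefficient_bounds[OF assms] by blast
  define P where "P = max M0 (4 * C)"
  have P: "P \<ge> M0" "P \<ge> 4 * C" "P \<ge> 1" unfolding P_def using M0 by auto
  have "4 * C * 1 \<le> P * P"
    using P C by (intro mult_mono) auto
  then have P2: "4 * C \<le> P ^ 2" by (simp add: power2_eq_square)
  define C1 where "C1 = (1 + C) ^ 2 + 1 + 2 * C"
  define C2 where "C2 = sqrt (4 * C1 * exp (60 * C))"
  define C3 where "C3 = (C2 + 1) * (P + 2 + \<nu>) powr \<nu>"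
  have "C1 > 0" unfolding C1_def using C by (simp add: add_nonneg_pos)
  then have "C2 \<ge> 0" unfolding C2_def by simp
  show thesis
  proof (rule that)
    show "C3 > 0"
      unfolding C3_def using P assms \<open>C2 \<ge> 0\<close> by simp
    fix s :: real and n :: nat
    assume s: "0 \<le> s" "s < 1"
    define \<kappa> where "\<kappa> = 1 - s ^ 2"
    have "s ^ 2 < 1" using s by (simp add: abs_square_less_1)
    then have \<kappa>: "0 < \<kappa>" "\<kappa> \<le> 1" unfolding \<kappa>_def by auto
    define K where "K = nat \<lceil>P / sqrt \<kappa>\<rceil>"
    have K_ge: "P / sqrt \<kappa> \<le> real K" unfolding K_def by linarith
    have "P / sqrt \<kappa> \<ge> 0" using P \<kappa> by simp
    then have K_le: "real K \<le> P / sqrt \<kappa> + 1" unfolding K_def by linarith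
    have "sqrt \<kappa> \<le> 1" using \<kappa> by simp
    have "P * sqrt \<kappa> \<le> P * 1" using P \<open>sqrt \<kappa> \<le> 1\<close> by (intro mult_left_mono) auto
    then have "P \<le> P / sqrt \<kappa>" using \<kappa> by (simp add: le_divide_eq)
    with K_ge have K_P: "real K \<ge> P" by linarith
    then have K1: "K \<ge> 1" using P by linarith
    have K_sq: "P ^ 2 / \<kappa> \<le> real K ^ 2"
    proof -
      have "(P / sqrt \<kappa>) ^ 2 \<le> real K ^ 2" using K_ge P \<kappa> by (intro power_mono) auto
      then show ?thesis using \<kappa> by (simp add: power_divide)
    qed
    let ?q = "gegenbauer \<nu> s"
    define v where "v = (\<lambda>n. (real n + \<nu>) powr \<nu> * ?q n)"
    define F where "F = (\<lambda>n. v (Suc n) ^ 2 - 2 * s * coupling \<nu> (real n + 1 + \<nu>) * v (Suc n) * v n + v n ^ 2)"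
    have q1: "\<bar>?q n\<bar> \<le> 1" for n
      using abs_gegenbauer_le_1[of \<nu> s n] assms s by simp
    \<comment> \<open>beyond the threshold, \<open>\<kappa> m\<^sup>2 \<ge> P\<^sup>2 \<ge> 4 C\<close> keeps the coupling within \<open>\<kappa> / 4\<close> of 1, while \<open>s \<le> 1 - \<kappa> / 2\<close>;
      this gap is what makes the energy coercive\<close>
    have small: "C / m ^ 2 \<le> \<kappa> / 4" "C / m ^ 2 \<le> 1 / 4" "C / m ^ 3 \<le> 1 / 4"
      if "m \<ge> real K" for m
    proof -
      have m: "m \<ge> 1" using that K_P P by linarith
      have "real K ^ 2 \<le> m ^ 2" using that by (intro power_mono) auto
      with K_sq have "P ^ 2 / \<kappa> \<le> m ^ 2" by linarith
      then have "P ^ 2 \<le> \<kappa> * m ^ 2" using \<kappa> by (simp add: field_simps)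
      with P2 have *: "4 * C \<le> \<kappa> * m ^ 2" by linarith
      then show "C / m ^ 2 \<le> \<kappa> / 4" using m by (simp add: field_simps)
      with \<kappa> show "C / m ^ 2 \<le> 1 / 4" by linarith
      moreover have "C / m ^ 3 \<le> C / m ^ 2"
        using m C by (intro divide_left_mono power_increasing) auto
      ultimately show "C / m ^ 3 \<le> 1 / 4" by linarith
    qed
    have coercive: "\<kappa> / 4 * (v n ^ 2 + v (Suc n) ^ 2) \<le> F n" if "n \<ge> K" for n
    proof -
      define b where "b = coupling \<nu> (real n + 1 + \<nu>)"
      have m: "real n + 1 + \<nu> \<ge> real K" using that assms by simp
      have b: "\<bar>b - 1\<bar> \<le> \<kappa> / 4"
        using b1[of "real n + 1 + \<nu>"] small(1)[OF m] m K_P P unfolding b_def by linarith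
      have "(1 - \<kappa> / 2) ^ 2 = (1 - \<kappa>) + (\<kappa> / 2) ^ 2"
        by (simp add: power2_eq_square algebra_simps)
      also have "1 - \<kappa> = s ^ 2" by (simp add: \<kappa>_def)
      finally have "s ^ 2 \<le> (1 - \<kappa> / 2) ^ 2" by simp
      then have "s \<le> 1 - \<kappa> / 2"
        by (rule power2_le_imp_le) (use \<kappa> in simp)
      moreover have "b \<le> 1 + \<kappa> / 4" "0 \<le> b" using b \<kappa> by linarith+
      ultimately have "s * b \<le> (1 - \<kappa> / 2) * (1 + \<kappa> / 4)"
        using s \<kappa> by (intro mult_mono) auto
      also have "\<dots> \<le> 1 - \<kappa> / 4"
        using \<kappa> by (simp add: algebra_simps)
      finally have sb: "s * b \<le> 1 - \<kappa> / 4" .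
      have "0 \<le> s * b" using s \<open>0 \<le> b\<close> by simp
      have "2 * (v (Suc n) * v n) \<le> v n ^ 2 + v (Suc n) ^ 2"
        using sum_squares_bound[of "v (Suc n)" "v n"] by simp
      then have "(s * b) * (2 * (v (Suc n) * v n)) \<le> (s * b) * (v n ^ 2 + v (Suc n) ^ 2)"
        using \<open>0 \<le> s * b\<close> by (rule mult_left_mono)
      also have "\<dots> \<le> (1 - \<kappa> / 4) * (v n ^ 2 + v (Suc n) ^ 2)"
        using sb by (intro mult_right_mono) auto
      finally show ?thesis unfolding F_def b_def by (simp add: algebra_simps)
    qed
    have F_nonneg: "0 \<le> F n" if "n \<ge> K" for n
      by (rule order_trans[OF _ coercive[OF that]]) (use \<kappa> in simp)
    have step: "F (Suc n) \<le> F n * (1 + (60 * C / \<kappa>) / real (Suc n) ^ 3)" if "n \<ge> K" for n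
    proof -
      define m where "m = real n + 1 + \<nu>"
      have m: "m \<ge> real K" "m \<ge> M0" "m \<ge> real (Suc n)"
        unfolding m_def using that assms K_P P by auto
      then have "m > 0" using M0 by linarith
      have m1: "real (Suc n) + 1 + \<nu> = m + 1" unfolding m_def by simp
      have "F (Suc n) \<le> F n + 15 * (C / m ^ 3) * (v n ^ 2 + v (Suc n) ^ 2)"
        unfolding F_def m1 m_def[symmetric]
      proof (rule recurrence_energy_step)
        show "v (Suc (Suc n)) + damping \<nu> m * v n = 2 * s * coupling \<nu> m * v (Suc n)"
          unfolding v_def m_def by (rule weighted_gegenbauer_recurrence[OF assms])
        show "\<bar>damping \<nu> m - 1\<bar> \<le> C / m ^ 3" "\<bar>coupling \<nu> (m + 1) - coupling \<nu> m\<bar> \<le> C / m ^ 3"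
          using g1 b2 m by auto
        show "\<bar>coupling \<nu> m\<bar> \<le> 2" "\<bar>damping \<nu> m\<bar> \<le> 2"
          using b1[OF m(2)] g1[OF m(2)] small[OF m(1)] by linarith+
      qed (use s in auto)
      also have "15 * (C / m ^ 3) * (v n ^ 2 + v (Suc n) ^ 2) \<le> 15 * (C / real (Suc n) ^ 3) * (4 / \<kappa> * F n)"
      proof (intro mult_mono)
        show "C / m ^ 3 \<le> C / real (Suc n) ^ 3"
          using m C by (intro divide_left_mono power_mono) auto
        show "v n ^ 2 + v (Suc n) ^ 2 \<le> 4 / \<kappa> * F n"
          using coercive[OF that] \<kappa> by (simp add: field_simps)
      qed (use C \<open>m > 0\<close> in auto)
      finally show ?thesis by (simp add: algebra_simps)
    qed
    have start: "F K \<le> \<kappa> * C1 * ((real K + 1 + \<nu>) powr \<nu>) ^ 2"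
    proof -
      define m where "m = real K + 1 + \<nu>"
      define b where "b = coupling \<nu> m"
      define \<rho> where "\<rho> = ((m - 1) / m) powr \<nu>"
      have m: "m \<ge> real K" "m > 1" unfolding m_def using assms by auto
      have vS: "v (Suc K) = m powr \<nu> * ?q (Suc K)" unfolding v_def m_def by (simp add: add.commute add.left_commute)
      have "(m - 1) powr \<nu> = m powr \<nu> * \<rho>" unfolding \<rho>_def using m by (simp add: powr_divide)
      then have vK: "v K = m powr \<nu> * (\<rho> * ?q K)" unfolding v_def m_def by simp
      have \<rho>: "0 \<le> \<rho>" "\<rho> \<le> 1"
        unfolding \<rho>_def using m assms powr_mono2[of \<nu> "(m - 1) / m" 1] by auto
      \<comment> \<open>the first difference is small by the unweighted energy; the weights perturb it by \<open>O(1 / m) = O(sqrt \<kappa>)\<close>\<close>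
      define d where "d = ?q (Suc K) - s * ?q K"
      have energy: "d ^ 2 + \<kappa> * ?q K ^ 2 \<le> \<kappa>"
        unfolding d_def \<kappa>_def by (rule gegenbauer_energy_le) (use assms in simp)
      have "0 \<le> \<kappa> * ?q K ^ 2" using \<kappa> by simp
      with energy have "d ^ 2 \<le> \<kappa>" by linarith
      from real_sqrt_le_mono[OF this] have "\<bar>d\<bar> \<le> sqrt \<kappa>" by simp
      moreover have "\<bar>s * ((1 - \<rho>) * ?q K)\<bar> \<le> 1 * (C * sqrt \<kappa> * 1)"
        unfolding abs_mult
      proof (intro mult_mono)
        have "P / sqrt \<kappa> \<le> m" using K_ge m by linarith
        then have "1 / sqrt \<kappa> \<le> m"
          using P(3) \<kappa> divide_right_mono[of 1 P "sqrt \<kappa>"] by simp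
        then have "C / m \<le> C * sqrt \<kappa>"
          using C m \<kappa> by (simp add: field_simps)
        then show "\<bar>1 - \<rho>\<bar> \<le> C * sqrt \<kappa>"
          using r1[of m] m K_P P unfolding \<rho>_def by linarith
      qed (use s q1 C \<kappa> in auto)
      ultimately have "\<bar>d + s * ((1 - \<rho>) * ?q K)\<bar> \<le> (1 + C) * sqrt \<kappa>"
        by (simp add: algebra_simps)
      then have "\<bar>d + s * ((1 - \<rho>) * ?q K)\<bar> ^ 2 \<le> ((1 + C) * sqrt \<kappa>) ^ 2"
        by (intro power_mono) auto
      then have t1: "(d + s * ((1 - \<rho>) * ?q K)) ^ 2 \<le> \<kappa> * (1 + C) ^ 2"
        using \<kappa> by (simp add: power_mult_distrib mult.commute)
      have t2: "\<kappa> * (\<rho> ^ 2 * ?q K ^ 2) \<le> \<kappa> * (1 * 1)"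
        using \<kappa> \<rho> q1[of K] by (intro mult_left_mono mult_mono) (auto simp: power_le_one abs_square_le_1)
      have t3: "\<bar>2 * (s * ((b - 1) * (\<rho> * (?q (Suc K) * ?q K))))\<bar> \<le> 2 * (1 * ((\<kappa> / 4) * (1 * (1 * 1))))"
        unfolding abs_mult
      proof (intro mult_mono)
        show "\<bar>b - 1\<bar> \<le> \<kappa> / 4"
          using b1[of m] small(1)[OF m(1)] m K_P P unfolding b_def by linarith
      qed (use s q1 \<rho> \<kappa> in auto)
      have "F K = (m powr \<nu>) ^ 2 * ((d + s * ((1 - \<rho>) * ?q K)) ^ 2 + (1 - s ^ 2) * (\<rho> ^ 2 * ?q K ^ 2)
          - 2 * (s * ((b - 1) * (\<rho> * (?q (Suc K) * ?q K)))))"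
        unfolding F_def vS vK m_def[symmetric] b_def[symmetric] d_def
        by (simp add: power2_eq_square algebra_simps)
      also have "\<dots> \<le> (m powr \<nu>) ^ 2 * (\<kappa> * (1 + C) ^ 2 + \<kappa> * 1 + \<kappa> * (2 * C))"
      proof (rule mult_left_mono)
        have "\<kappa> * 1 \<le> \<kappa> * C" using C \<kappa> by (intro mult_left_mono) auto
        then show "(d + s * ((1 - \<rho>) * ?q K)) ^ 2 + (1 - s ^ 2) * (\<rho> ^ 2 * ?q K ^ 2)
          - 2 * (s * ((b - 1) * (\<rho> * (?q (Suc K) * ?q K)))) \<le> \<kappa> * (1 + C) ^ 2 + \<kappa> * 1 + \<kappa> * (2 * C)"
          using t1 t2 t3 \<kappa> unfolding \<kappa>_def[symmetric] by linarith
      qed simp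
      finally show ?thesis unfolding C1_def m_def by (simp add: algebra_simps)
    qed
    have scale: "((real j + \<nu>) * sqrt \<kappa>) powr \<nu> \<le> (P + 2 + \<nu>) powr \<nu>" if "j \<le> Suc K" for j
    proof (rule powr_mono2)
      have "real j + \<nu> \<le> P / sqrt \<kappa> + 2 + \<nu>" using that K_le by linarith
      then have "(real j + \<nu>) * sqrt \<kappa> \<le> (P / sqrt \<kappa> + 2 + \<nu>) * sqrt \<kappa>"
        using \<kappa> by (intro mult_right_mono) auto
      also have "\<dots> = P + (2 + \<nu>) * sqrt \<kappa>" using \<kappa> by (simp add: algebra_simps)
      also have "\<dots> \<le> P + (2 + \<nu>) * 1"
        using \<open>sqrt \<kappa> \<le> 1\<close> assms by (intro add_left_mono mult_left_mono) auto
      finally show "(real j + \<nu>) * sqrt \<kappa> \<le> P + 2 + \<nu>" by simp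
    qed (use assms \<kappa> in auto)
    have "\<bar>?q n\<bar> * ((real n + \<nu>) * sqrt \<kappa>) powr \<nu> \<le> C3"
    proof (cases "n \<ge> K")
      case True
      have "F n \<le> F K * exp ((60 * C / \<kappa>) / real K ^ 2)"
        using K1 C \<kappa> F_nonneg step True by (intro discrete_gronwall_cubic) auto
      also have "\<dots> \<le> F K * exp (60 * C)"
      proof -
        have "1 / \<kappa> \<le> real K ^ 2"
          using K_sq P(3) \<kappa> divide_right_mono[of 1 "P ^ 2" \<kappa>] by simp
        then have "1 \<le> \<kappa> * real K ^ 2" using \<kappa> by (simp add: field_simps)
        then have "60 * C * 1 \<le> 60 * C * (\<kappa> * real K ^ 2)" using C by (intro mult_left_mono) auto
        then have "(60 * C / \<kappa>) / real K ^ 2 \<le> 60 * C"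
          using \<kappa> K1 by (simp add: divide_le_eq)
        then show ?thesis using F_nonneg[of K] by (intro mult_left_mono) auto
      qed
      also have "\<dots> \<le> \<kappa> * C1 * ((real K + 1 + \<nu>) powr \<nu>) ^ 2 * exp (60 * C)"
        using start by (intro mult_right_mono) auto
      finally have F_le: "F n \<le> \<kappa> * C1 * ((real K + 1 + \<nu>) powr \<nu>) ^ 2 * exp (60 * C)" .
      have "\<kappa> / 4 * v n ^ 2 \<le> \<kappa> / 4 * (v n ^ 2 + v (Suc n) ^ 2)"
        using \<kappa> by (intro mult_left_mono) auto
      then have "\<kappa> * v n ^ 2 \<le> 4 * (\<kappa> * C1 * ((real K + 1 + \<nu>) powr \<nu>) ^ 2 * exp (60 * C))"
        using coercive[OF True] F_le by linarith
      also have "\<dots> = \<kappa> * ((4 * C1 * exp (60 * C)) * ((real K + 1 + \<nu>) powr \<nu>) ^ 2)"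
        by simp
      finally have "v n ^ 2 \<le> (4 * C1 * exp (60 * C)) * ((real K + 1 + \<nu>) powr \<nu>) ^ 2"
        using \<kappa> by (simp only: mult_le_cancel_left_pos)
      also have "\<dots> = (C2 * (real K + 1 + \<nu>) powr \<nu>) ^ 2"
        unfolding C2_def using \<open>C1 > 0\<close> by (simp add: power_mult_distrib)
      finally have "\<bar>v n\<bar> ^ 2 \<le> (C2 * (real K + 1 + \<nu>) powr \<nu>) ^ 2"
        by simp
      then have "\<bar>v n\<bar> \<le> C2 * (real K + 1 + \<nu>) powr \<nu>"
        by (rule power2_le_imp_le) (use \<open>C2 \<ge> 0\<close> in simp)
      then have "\<bar>v n\<bar> * sqrt \<kappa> powr \<nu> \<le> C2 * (real K + 1 + \<nu>) powr \<nu> * sqrt \<kappa> powr \<nu>"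
        by (rule mult_right_mono) simp
      also have "\<dots> = C2 * ((real (Suc K) + \<nu>) * sqrt \<kappa>) powr \<nu>"
        using \<kappa> assms by (simp add: powr_mult add.commute add.left_commute)
      also have "\<dots> \<le> C2 * (P + 2 + \<nu>) powr \<nu>"
        using scale[of "Suc K"] \<open>C2 \<ge> 0\<close> by (intro mult_left_mono) auto
      also have "\<dots> \<le> C3" unfolding C3_def by (simp add: distrib_right)
      also have "\<bar>v n\<bar> * sqrt \<kappa> powr \<nu> = \<bar>?q n\<bar> * ((real n + \<nu>) * sqrt \<kappa>) powr \<nu>"
        using \<kappa> assms by (simp add: v_def abs_mult powr_mult)
      finally show ?thesis .
    next
      case False
      then have "\<bar>?q n\<bar> * ((real n + \<nu>) * sqrt \<kappa>) powr \<nu> \<le> 1 * (P + 2 + \<nu>) powr \<nu>"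
        using q1[of n] scale[of n] by (intro mult_mono) auto
      also have "\<dots> \<le> C3" unfolding C3_def using \<open>C2 \<ge> 0\<close> by (intro mult_right_mono) auto
      finally show ?thesis .
    qed
    then show "\<bar>?q n\<bar> * ((real n + \<nu>) * sqrt (1 - s ^ 2)) powr \<nu> \<le> C3"
      unfolding \<kappa>_def .
  qed
qed

section \<open>Residual polynomials of the Nesterov iteration\<close>

text \<open>
  The iteration run on polynomials: applied to \<open>T\<close> and then to \<open>A\<^sup>*y\<close>, these give the iterates.
\<close>

fun nesterov_poly :: "(nat \<Rightarrow> real) \<Rightarrow> nat \<Rightarrow> real poly" where
  "nesterov_poly \<alpha> 0 = 0"
| "nesterov_poly \<alpha> (Suc 0) = 1"
| "nesterov_poly \<alpha> (Suc (Suc n)) =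
     (let z = nesterov_poly \<alpha> (Suc n) + smult (\<alpha> (Suc n)) (nesterov_poly \<alpha> (Suc n) - nesterov_poly \<alpha> n)
      in z + (1 - [:0, 1:] * z))"

definition residual_poly :: "(nat \<Rightarrow> real) \<Rightarrow> nat \<Rightarrow> real poly" where
  "residual_poly \<alpha> n = 1 - [:0, 1:] * nesterov_poly \<alpha> n"

lemma poly_residual_simps:
  "poly (residual_poly \<alpha> 0) t = 1"
  "poly (residual_poly \<alpha> (Suc 0)) t = 1 - t"
  "poly (residual_poly \<alpha> (Suc (Suc n))) t = (1 - t) * (poly (residual_poly \<alpha> (Suc n)) t
     + \<alpha> (Suc n) * (poly (residual_poly \<alpha> (Suc n)) t - poly (residual_poly \<alpha> n) t))"
  by (auto simp: residual_poly_def Let_def algebra_simps)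

text \<open>
  The momentum parameter is \<open>(k - 1) / (k + \<beta>)\<close> with \<open>\<beta> = 2 \<nu> - 1\<close>. The residual polynomials satisfy
  \<open>r\<^sub>k\<^sub>+\<^sub>1 = (1 - t) (r\<^sub>k + \<alpha>\<^sub>k (r\<^sub>k - r\<^sub>k\<^sub>-\<^sub>1))\<close>, and splitting off a factor \<open>s\<close> per step distributes the
  contraction \<open>1 - t = s\<^sup>2\<close> evenly and leaves the Gegenbauer recurrence.
\<close>

lemma residual_eq_gegenbauer:
  fixes \<nu> :: real
  assumes "t \<le> 1" "\<nu> > 0"
  shows "poly (residual_poly (\<lambda>j. (real j - 1) / (real j + (2 * \<nu> - 1))) (Suc n)) t
      = sqrt (1 - t) ^ (n + 2) * gegenbauer \<nu> (sqrt (1 - t)) n"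
proof -
  define s where "s = sqrt (1 - t)"
  have s: "1 - t = s ^ 2" unfolding s_def using assms by simp
  define \<alpha> where "\<alpha> = (\<lambda>j. (real j - 1) / (real j + (2 * \<nu> - 1)))"
  have "poly (residual_poly \<alpha> (Suc n)) t = s ^ (n + 2) * gegenbauer \<nu> s n"
  proof (induction n rule: less_induct)
    case (less n)
    consider "n = 0" | "n = 1" | m where "n = Suc (Suc m)"
      by (metis One_nat_def not0_implies_Suc)
    then show ?case
    proof cases
      case 1
      then show ?thesis by (simp add: poly_residual_simps s power2_eq_square)
    next
      case 2
      then show ?thesis by (simp add: poly_residual_simps s \<alpha>_def power2_eq_square)
    next
      case 3
      have \<alpha>: "\<alpha> (Suc (Suc m)) = (real m + 1) / (real m + 1 + 2 * \<nu>)"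
        by (simp add: \<alpha>_def algebra_simps)
      define a where "a = (real m + 1) / (real m + 1 + 2 * \<nu>)"
      have "poly (residual_poly \<alpha> (Suc n)) t
          = s ^ 2 * (s ^ (Suc m + 2) * gegenbauer \<nu> s (Suc m)
             + a * (s ^ (Suc m + 2) * gegenbauer \<nu> s (Suc m) - s ^ (m + 2) * gegenbauer \<nu> s m))"
        unfolding 3 poly_residual_simps(3)[of \<alpha> "Suc m"] \<alpha> a_def[symmetric] s
        using less[of m] less[of "Suc m"] 3 by simp
      also have "\<dots> = s ^ (n + 2) * ((1 + a) * s * gegenbauer \<nu> s (Suc m) - a * gegenbauer \<nu> s m)"
        unfolding 3 by (simp add: power2_eq_square algebra_simps del: gegenbauer.simps)
      also have "(1 + a) * s * gegenbauer \<nu> s (Suc m) - a * gegenbauer \<nu> s m = gegenbauer \<nu> s n"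
        unfolding 3 by (simp add: Let_def a_def)
      finally show ?thesis .
    qed
  qed
  then show ?thesis unfolding \<alpha>_def s_def .
qed

lemma abs_residual_le_1:
  fixes \<nu> t :: real
  assumes "\<nu> > 0" "0 \<le> t" "t \<le> 1"
  shows "\<bar>poly (residual_poly (\<lambda>j. (real j - 1) / (real j + (2 * \<nu> - 1))) n) t\<bar> \<le> 1"
proof (cases n)
  case (Suc m)
  have "sqrt (1 - t) ^ (m + 2) \<le> 1"
    using assms by (intro power_le_one) auto
  then have "\<bar>sqrt (1 - t) ^ (m + 2)\<bar> \<le> 1"
    using assms by (simp add: abs_of_nonneg del: power_add power_Suc)
  then have "\<bar>sqrt (1 - t) ^ (m + 2)\<bar> * \<bar>gegenbauer \<nu> (sqrt (1 - t)) m\<bar> \<le> 1 * 1"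
    using assms abs_gegenbauer_le_1[of \<nu> "sqrt (1 - t)" m]
    by (intro mult_mono) auto
  then show ?thesis
    using assms by (simp only: Suc residual_eq_gegenbauer abs_mult)
qed (simp add: poly_residual_simps)

text \<open>
  One increment of the residual is the previous one damped, plus at most \<open>t\<close>; so the increments grow at
  most linearly and the deviation from 1 at most quadratically in the index.
\<close>

lemma residual_deviation_le:
  assumes \<alpha>: "\<And>n. \<bar>\<alpha> (Suc n)\<bar> \<le> 1" and t: "0 \<le> t" "t \<le> 1"
    and r: "\<And>n. \<bar>poly (residual_poly \<alpha> n) t\<bar> \<le> 1"
  shows "\<bar>1 - poly (residual_poly \<alpha> n) t\<bar> \<le> real n ^ 2 * t"
proof -
  let ?r = "\<lambda>n. poly (residual_poly \<alpha> n) t"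
  have incr: "\<bar>?r (Suc n) - ?r n\<bar> \<le> real (Suc n) * t" for n
  proof (induction n)
    case 0
    then show ?case using t by (simp add: poly_residual_simps)
  next
    case (Suc n)
    have "?r (Suc (Suc n)) - ?r (Suc n) = (1 - t) * (\<alpha> (Suc n) * (?r (Suc n) - ?r n)) - t * ?r (Suc n)"
      by (simp add: poly_residual_simps(3) algebra_simps)
    moreover have "\<bar>(1 - t) * (\<alpha> (Suc n) * (?r (Suc n) - ?r n))\<bar> \<le> 1 * (1 * (real (Suc n) * t))"
      unfolding abs_mult using Suc \<alpha>[of n] t by (intro mult_mono) auto
    moreover have "\<bar>t * ?r (Suc n)\<bar> \<le> t * 1"
      unfolding abs_mult using r[of "Suc n"] t by (intro mult_mono) auto
    ultimately show ?case by (simp add: algebra_simps)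
  qed
  show ?thesis
  proof (induction n)
    case (Suc n)
    have "\<bar>1 - ?r (Suc n)\<bar> \<le> real n ^ 2 * t + real (Suc n) * t"
      using Suc incr[of n] by linarith
    also have "\<dots> \<le> real (Suc n) ^ 2 * t"
    proof -
      have "real n ^ 2 + real (Suc n) \<le> real (Suc n) ^ 2"
        by (simp add: power2_eq_square algebra_simps)
      then show ?thesis using t mult_right_mono[of "real n ^ 2 + real (Suc n)" "real (Suc n) ^ 2" t]
        by (simp only: distrib_right)
    qed
    finally show ?case .
  qed (simp add: poly_residual_simps)
qed

text \<open>
  With \<open>t g = 1 - r\<close>, the bound is the product of \<open>\<bar>1 - r\<bar> \<le> 2\<close> and \<open>\<bar>1 - r\<bar> \<le> n\<^sup>2 t\<close>, divided by \<open>t\<close>.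
\<close>

lemma nesterov_poly_bound:
  assumes \<alpha>: "\<And>n. \<bar>\<alpha> (Suc n)\<bar> \<le> 1" and t: "0 \<le> t" "t \<le> 1"
    and r: "\<And>n. \<bar>poly (residual_poly \<alpha> n) t\<bar> \<le> 1"
  shows "t * poly (nesterov_poly \<alpha> n) t ^ 2 \<le> 2 * real n ^ 2"
proof (cases "t = 0")
  case False
  then have "t > 0" using t by simp
  let ?g = "poly (nesterov_poly \<alpha> n) t"
  have dev: "1 - poly (residual_poly \<alpha> n) t = t * ?g"
    by (simp add: residual_poly_def)
  have "\<bar>t * ?g\<bar> * \<bar>t * ?g\<bar> \<le> 2 * (real n ^ 2 * t)"
  proof (rule mult_mono)
    show "\<bar>t * ?g\<bar> \<le> 2" using r[of n] unfolding dev[symmetric] by linarith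
    show "\<bar>t * ?g\<bar> \<le> real n ^ 2 * t"
      using residual_deviation_le[OF assms, of n] unfolding dev .
  qed auto
  then have "t * (t * ?g ^ 2) \<le> t * (2 * real n ^ 2)"
    using t by (simp add: abs_mult power2_eq_square algebra_simps)
  then show ?thesis using \<open>t > 0\<close> by simp
qed simp

text \<open>
  The Gegenbauer decay in terms of the iteration index. The constant \<open>L\<close> passes from \<open>n + \<nu>\<close> to
  \<open>k = n + 1\<close>, which matters for \<open>\<nu> < 1\<close>.
\<close>

lemma residual_decay:
  fixes \<nu> :: real
  assumes "\<nu> > 0"
  obtains C where "C \<ge> 1"
    "\<And>t k. 0 < t \<Longrightarrow> t \<le> 1 \<Longrightarrow> k \<ge> 1 \<Longrightarrow>
      \<bar>poly (residual_poly (\<lambda>j. (real j - 1) / (real j + (2 * \<nu> - 1))) k) t\<bar> * (real k * sqrt t) powr \<nu>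
        \<le> C * sqrt (1 - t) ^ k"
proof -
  obtain C where C: "C > 0" "\<And>s n. 0 \<le> s \<Longrightarrow> s < 1 \<Longrightarrow>
      \<bar>gegenbauer \<nu> s n\<bar> * ((real n + \<nu>) * sqrt (1 - s ^ 2)) powr \<nu> \<le> C"
    using gegenbauer_decay[OF assms] by blast
  define L where "L = max 1 (1 / \<nu>)"
  have L: "L \<ge> 1" "L * \<nu> \<ge> 1"
    unfolding L_def using assms by (auto simp: max_def field_simps)
  define C' where "C' = max 1 (L powr \<nu> * C)"
  show thesis
  proof (rule that)
    show "C' \<ge> 1" unfolding C'_def by simp
    fix t :: real and k :: nat
    assume t: "0 < t" "t \<le> 1" and "k \<ge> 1"
    then obtain n where k: "k = Suc n" by (cases k) auto
    define s where "s = sqrt (1 - t)"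
    have s: "0 \<le> s" "s < 1" "1 - s ^ 2 = t" unfolding s_def using t by auto
    have "real k \<le> L * (real n + \<nu>)"
    proof -
      have "1 * real n \<le> L * real n" using L by (intro mult_right_mono) auto
      then show ?thesis unfolding k using L by (simp add: distrib_left)
    qed
    then have "real k * sqrt t \<le> L * ((real n + \<nu>) * sqrt t)"
      using mult_right_mono[of "real k" "L * (real n + \<nu>)" "sqrt t"] t by (simp add: mult.assoc)
    then have "(real k * sqrt t) powr \<nu> \<le> (L * ((real n + \<nu>) * sqrt t)) powr \<nu>"
      using t assms by (intro powr_mono2) auto
    also have "\<dots> = L powr \<nu> * ((real n + \<nu>) * sqrt t) powr \<nu>"
      by (rule powr_mult)
    finally have "\<bar>gegenbauer \<nu> s n\<bar> * (real k * sqrt t) powr \<nu>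
        \<le> \<bar>gegenbauer \<nu> s n\<bar> * (L powr \<nu> * ((real n + \<nu>) * sqrt t) powr \<nu>)"
      by (intro mult_left_mono) auto
    also have "\<dots> = L powr \<nu> * (\<bar>gegenbauer \<nu> s n\<bar> * ((real n + \<nu>) * sqrt t) powr \<nu>)"
      by simp
    also have "\<dots> \<le> L powr \<nu> * C"
      using C(2)[OF s(1,2), of n] unfolding s(3) by (intro mult_left_mono) auto
    also have "\<dots> \<le> C'" unfolding C'_def by simp
    finally have q: "\<bar>gegenbauer \<nu> s n\<bar> * (real k * sqrt t) powr \<nu> \<le> C'" .
    have "s ^ (n + 2) * (\<bar>gegenbauer \<nu> s n\<bar> * (real k * sqrt t) powr \<nu>) \<le> s ^ k * C'"
    proof (rule mult_mono)
      show "s ^ (n + 2) \<le> s ^ k" unfolding k using s by (intro power_decreasing) auto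
    qed (use q s in auto)
    then show "\<bar>poly (residual_poly (\<lambda>j. (real j - 1) / (real j + (2 * \<nu> - 1))) k) t\<bar> * (real k * sqrt t) powr \<nu>
        \<le> C' * sqrt (1 - t) ^ k"
      unfolding k residual_eq_gegenbauer[OF t(2) assms] s_def[symmetric]
      using s by (simp add: abs_mult mult_ac)
  qed
qed

lemma powr_le_exp:
  fixes x \<tau> :: real
  assumes "x \<ge> 0" "\<tau> > 0"
  shows "x powr \<tau> \<le> (2 * \<tau>) powr \<tau> * exp (x / 2)"
proof -
  have "x / (2 * \<tau>) \<le> exp (x / (2 * \<tau>))"
    using exp_ge_add_one_self[of "x / (2 * \<tau>)"] by linarith
  then have "(x / (2 * \<tau>)) powr \<tau> \<le> exp (x / (2 * \<tau>)) powr \<tau>"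
    using assms by (intro powr_mono2) auto
  also have "\<dots> = exp (x / 2)"
    using assms by (simp add: powr_def)
  finally show ?thesis
    using assms by (simp add: powr_divide field_simps)
qed

text \<open>
  For \<open>2 \<mu> \<le> \<nu>\<close> the polynomial decay in \<open>X = k sqrt t\<close> beats the factor \<open>X powr (2 \<mu>)\<close>. Beyond
  saturation the excess power \<open>\<tau> = \<mu> - \<nu> / 2\<close> of \<open>t\<close> has to be absorbed by the factor
  \<open>(1 - t) powr (k / 2) \<le> exp (- k t / 2)\<close>, which gains only a factor \<open>k powr - \<tau>\<close> instead of \<open>k powr (- 2 \<tau>)\<close>.
\<close>

lemma residual_rate:
  fixes \<nu> \<mu> :: real
  assumes "\<nu> > 0" "\<mu> > 0"
  defines "\<rho> \<equiv> min (2 * \<mu>) (\<mu> + \<nu> / 2)"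
  obtains C where "C > 0"
    "\<And>t k. 0 \<le> t \<Longrightarrow> t \<le> 1 \<Longrightarrow> k \<ge> 1 \<Longrightarrow>
      \<bar>poly (residual_poly (\<lambda>j. (real j - 1) / (real j + (2 * \<nu> - 1))) k) t\<bar> * t powr \<mu> \<le> C * real k powr - \<rho>"
proof -
  let ?r = "\<lambda>k. poly (residual_poly (\<lambda>j. (real j - 1) / (real j + (2 * \<nu> - 1))) k)"
  obtain C where C: "C \<ge> 1" and dec: "\<And>t k. 0 < t \<Longrightarrow> t \<le> 1 \<Longrightarrow> k \<ge> 1 \<Longrightarrow>
      \<bar>?r k t\<bar> * (real k * sqrt t) powr \<nu> \<le> C * sqrt (1 - t) ^ k"
    using residual_decay[OF assms(1)] by blast
  define \<tau> where "\<tau> = \<mu> - \<nu> / 2"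
  define C' where "C' = max C (C * (2 * \<tau>) powr \<tau>)"
  have "C' > 0" unfolding C'_def using C by simp
  have bound: "\<bar>?r k t\<bar> * t powr \<mu> * real k powr \<rho> \<le> C'" if t: "0 < t" "t \<le> 1" and k: "k \<ge> 1" for t k
  proof (cases "2 * \<mu> \<le> \<nu>")
    case True
    then have \<rho>: "\<rho> = 2 * \<mu>" unfolding \<rho>_def by simp
    define X where "X = real k * sqrt t"
    have X: "X > 0" unfolding X_def using t k by simp
    have "t powr \<mu> = sqrt t powr (2 * \<mu>)"
      using t by (simp add: powr_half_sqrt[symmetric] powr_powr)
    then have "t powr \<mu> * real k powr \<rho> = X powr (2 * \<mu>)"
      unfolding X_def \<rho> using t by (simp add: powr_mult mult.commute)
    then have eq: "\<bar>?r k t\<bar> * t powr \<mu> * real k powr \<rho> = \<bar>?r k t\<bar> * X powr (2 * \<mu>)"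
      by simp
    also have "\<dots> \<le> C"
    proof (cases "X \<le> 1")
      case True
      then have "\<bar>?r k t\<bar> * X powr (2 * \<mu>) \<le> 1 * 1"
        using abs_residual_le_1[OF assms(1), of t k] t X assms(2)
        by (intro mult_mono) (auto intro!: powr_le1)
      then show ?thesis using C by linarith
    next
      case False
      have "\<bar>?r k t\<bar> * X powr (2 * \<mu>) \<le> \<bar>?r k t\<bar> * X powr \<nu>"
        using False True by (intro mult_left_mono powr_mono) auto
      also have "\<dots> \<le> C * sqrt (1 - t) ^ k"
        unfolding X_def by (rule dec[OF t k])
      also have "\<dots> \<le> C * 1"
        using C t by (intro mult_left_mono power_le_one) auto
      finally show ?thesis by simp
    qed
    also have "\<dots> \<le> C'" unfolding C'_def by simp
    finally show ?thesis .
  next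
    case False
    then have \<rho>: "\<rho> = \<mu> + \<nu> / 2" and "\<tau> > 0" unfolding \<rho>_def \<tau>_def by auto
    define y where "y = real k * t"
    have y: "y > 0" unfolding y_def using t k by simp
    have "t powr \<mu> = sqrt t powr \<nu> * t powr \<tau>"
      using t by (simp add: \<tau>_def powr_half_sqrt[symmetric] powr_powr flip: powr_add)
    moreover have "real k powr \<rho> = real k powr \<nu> * real k powr \<tau>"
      by (simp add: \<tau>_def \<rho> add.commute flip: powr_add)
    ultimately have "t powr \<mu> * real k powr \<rho> = (real k * sqrt t) powr \<nu> * y powr \<tau>"
      by (simp add: y_def powr_mult)
    then have "\<bar>?r k t\<bar> * t powr \<mu> * real k powr \<rho> = (\<bar>?r k t\<bar> * (real k * sqrt t) powr \<nu>) * y powr \<tau>"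
      by (simp add: mult.assoc)
    also have "\<dots> \<le> (C * exp (- (y / 2))) * ((2 * \<tau>) powr \<tau> * exp (y / 2))"
    proof (rule mult_mono)
      have "1 - t \<le> exp (- t)" using exp_ge_add_one_self[of "- t"] by simp
      then have "sqrt (1 - t) \<le> sqrt (exp (- t))" by (rule real_sqrt_le_mono)
      also have "sqrt (exp (- t)) = exp (- t / 2)"
        by (rule real_sqrt_unique) (simp_all add: flip: exp_double)
      finally have "sqrt (1 - t) ^ k \<le> exp (- t / 2) ^ k"
        using t by (intro power_mono) auto
      also have "\<dots> = exp (- (y / 2))"
        by (simp add: y_def flip: exp_of_nat_mult)
      finally have "C * sqrt (1 - t) ^ k \<le> C * exp (- (y / 2))"
        using C by (intro mult_left_mono) auto
      then show "\<bar>?r k t\<bar> * (real k * sqrt t) powr \<nu> \<le> C * exp (- (y / 2))"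
        using dec[OF t k] by linarith
      show "y powr \<tau> \<le> (2 * \<tau>) powr \<tau> * exp (y / 2)"
        using y \<open>\<tau> > 0\<close> by (intro powr_le_exp) auto
    qed (use C in auto)
    also have "\<dots> = C * (2 * \<tau>) powr \<tau>"
      by (simp add: exp_minus field_simps)
    also have "\<dots> \<le> C'" unfolding C'_def by simp
    finally show ?thesis .
  qed
  show thesis
  proof (rule that[OF \<open>C' > 0\<close>])
    fix t :: real and k :: nat
    assume t: "0 \<le> t" "t \<le> 1" and k: "k \<ge> 1"
    show "\<bar>?r k t\<bar> * t powr \<mu> \<le> C' * real k powr - \<rho>"
    proof (cases "t = 0")
      case False
      then show ?thesis
        using bound[of t k] t k by (simp add: powr_minus field_simps)
    qed (use \<open>C' > 0\<close> in simp)
  qed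
qed

section \<open>Error bounds and convergence rates\<close>

text \<open>
  From \<open>\<parallel>A x\<parallel>\<^sup>2 = inner (T x) x\<close> one gets \<open>\<parallel>A x\<parallel> \<le> \<parallel>x\<parallel>\<close>, and then \<open>\<parallel>T x\<parallel> \<le> \<parallel>A x\<parallel>\<close>, whose square is the
  inequality \<open>T\<^sup>2 \<le> T\<close>.
\<close>

lemma positive_contraction_normal:
  fixes A :: "'a::{real_inner, complete_space} \<Rightarrow> 'b::real_inner"
  assumes A: "bounded_linear A" and "onorm (adjoint A \<circ> A) \<le> 1"
  shows "positive_contraction (adjoint A \<circ> A)"
proof (rule positive_contraction.intro)
  note adj = adjoint_hilbert[OF A]
  show bl: "bounded_linear (adjoint A \<circ> A)"
    using bounded_linear_compose[OF bounded_linear_adjoint_hilbert[OF A] A] by (simp add: comp_def)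
  show "inner ((adjoint A \<circ> A) x) y = inner x ((adjoint A \<circ> A) y)" for x y
    by (metis adj comp_apply inner_commute)
  show "norm ((adjoint A \<circ> A) x) ^ 2 \<le> inner ((adjoint A \<circ> A) x) x" for x
  proof -
    define T where "T = adjoint A \<circ> A"
    have T: "inner (T x) x = norm (A x) ^ 2" for x
      using adj[of x "A x"] by (simp add: T_def power2_norm_eq_inner inner_commute)
    have "norm (T x) \<le> norm x" for x
    proof -
      have "norm (T x) \<le> onorm T * norm x" unfolding T_def by (rule onorm[OF bl])
      also have "\<dots> \<le> 1 * norm x" using assms(2) by (intro mult_right_mono) (auto simp: T_def)
      finally show ?thesis by simp
    qed
    then have "norm (A x) ^ 2 \<le> norm x ^ 2" for x
      using norm_cauchy_schwarz[of "T x" x] mult_right_mono[of "norm (T x)" "norm x" "norm x"]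
      by (metis T norm_ge_zero order_trans power2_eq_square)
    then have A_le: "norm (A x) \<le> norm x" for x
      by (rule power2_le_imp_le) simp
    have "norm (T x) * norm (T x) \<le> norm (T x) * norm (A x)"
    proof -
      have "norm (T x) * norm (T x) = inner (A (T x)) (A x)"
        by (simp add: adj T_def flip: power2_norm_eq_inner power2_eq_square)
      also have "\<dots> \<le> norm (A (T x)) * norm (A x)" by (rule norm_cauchy_schwarz)
      also have "\<dots> \<le> norm (T x) * norm (A x)" by (intro mult_right_mono A_le) simp
      finally show ?thesis .
    qed
    then have "norm (T x) \<le> norm (A x)"
      by (cases "norm (T x) = 0") auto
    then show ?thesis
      unfolding T_def[symmetric] T by (intro power_mono) auto
  qed
qed

lemma nesterov_eq_poly_op:
  fixes A :: "'a::{real_inner, complete_space} \<Rightarrow> 'b::real_inner"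
  assumes A: "bounded_linear A"
  shows "nesterov A \<alpha> y n = poly_op (nesterov_poly \<alpha> n) (adjoint A \<circ> A) (adjoint A y)"
proof -
  interpret adj: bounded_linear "adjoint A" by (rule bounded_linear_adjoint_hilbert[OF A])
  have bl: "bounded_linear (adjoint A \<circ> A)"
    using bounded_linear_compose[OF adj.bounded_linear_axioms A] by (simp add: comp_def)
  show ?thesis
  proof (induction \<alpha> n rule: nesterov_poly.induct)
    case (3 \<alpha> n)
    have X: "poly_op ([:0, 1:] * p) (adjoint A \<circ> A) x = adjoint A (A (poly_op p (adjoint A \<circ> A) x))" for p x
      by (simp only: poly_op_mult[OF bl]) (simp add: poly_op_pCons[OF bounded_linear.linear[OF bl]] linear_0[OF bounded_linear.linear[OF A]] adj.zero)
    show ?case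
      by (simp only: nesterov.simps nesterov_poly.simps Let_def 3 adj.diff poly_op_add poly_op_diff poly_op_smult
          poly_op_1 X)
  qed auto
qed

text \<open>
  By duality it suffices to bound \<open>A g(T)\<close>, and \<open>\<parallel>A g(T) x\<parallel>\<^sup>2 = inner x (h(T) x)\<close> for the polynomial
  \<open>h(t) = t g(t)\<^sup>2\<close>.
\<close>

lemma norm_poly_op_adjoint_le:
  fixes A :: "'a::{real_inner, complete_space} \<Rightarrow> 'b::real_inner"
  assumes A: "bounded_linear A" and "onorm (adjoint A \<circ> A) \<le> 1"
    and M: "M \<ge> 0" "\<And>t. 0 \<le> t \<Longrightarrow> t \<le> 1 \<Longrightarrow> t * poly g t ^ 2 \<le> M ^ 2"
  shows "norm (poly_op g (adjoint A \<circ> A) (adjoint A y)) \<le> M * norm y"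
proof -
  define T where "T = adjoint A \<circ> A"
  interpret positive_contraction T
    unfolding T_def by (rule positive_contraction_normal[OF assms(1,2)])
  note adj = adjoint_hilbert[OF A]
  have sa: "inner (poly_op p T x) z = inner x (poly_op p T z)" for p x z
    by (rule poly_op_self_adjoint[OF bounded_linear_T self_adjoint])
  have T: "T z = poly_op [:0, 1:] T z" for z
    by (simp add: poly_op_pCons[OF bounded_linear.linear[OF bounded_linear_T]]
        linear_0[OF bounded_linear.linear[OF bounded_linear_T]])
  have A_le: "norm (A (poly_op g T x)) \<le> M * norm x" for x
  proof -
    have "norm (A (poly_op g T x)) ^ 2 = inner (poly_op g T x) (T (poly_op g T x))"
      by (simp add: power2_norm_eq_inner adj T_def)
    also have "\<dots> = inner x (poly_op (g * ([:0, 1:] * g)) T x)"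
      by (simp only: poly_op_mult[OF bounded_linear_T] sa T)
    also have "\<dots> \<le> norm x * norm (poly_op (g * ([:0, 1:] * g)) T x)"
      by (rule norm_cauchy_schwarz)
    also have "\<dots> \<le> norm x * (M ^ 2 * norm x)"
    proof (intro mult_left_mono norm_poly_op_le_unit_interval)
      show "\<bar>poly (g * ([:0, 1:] * g)) t\<bar> \<le> M ^ 2" if "t \<in> {0..1}" for t
        using that M(2)[of t] by (simp add: power2_eq_square abs_mult mult_ac)
    qed simp
    also have "\<dots> = (M * norm x) ^ 2" by (simp add: power2_eq_square)
    finally show ?thesis by (rule power2_le_imp_le) (use M in simp)
  qed
  define u where "u = poly_op g T (adjoint A y)"
  have "norm u * norm u = inner u u"
    by (simp flip: power2_norm_eq_inner power2_eq_square)
  also have "\<dots> = inner (adjoint A y) (poly_op g T u)"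
    unfolding u_def by (rule sa)
  also have "\<dots> = inner (A (poly_op g T u)) y"
    by (simp only: adj inner_commute[of "adjoint A y"])
  also have "\<dots> \<le> norm (A (poly_op g T u)) * norm y" by (rule norm_cauchy_schwarz)
  also have "\<dots> \<le> M * norm u * norm y" by (intro mult_right_mono A_le) simp
  finally have "norm u * norm u \<le> norm u * (M * norm y)" by (simp add: mult_ac)
  then have "norm u \<le> M * norm y"
    using M(1) by (cases "norm u = 0") auto
  then show ?thesis unfolding u_def T_def .
qed

text \<open>
  The two terms are the approximation error, controlled through the source condition, and the propagated
  data noise.
\<close>

lemma nesterov_error_bound:
  fixes A :: "'a::{real_inner, complete_space} \<Rightarrow> 'b::real_inner"
  assumes A: "bounded_linear A" "onorm (adjoint A \<circ> A) \<le> 1" and pos: "\<beta> > -1" "\<mu> > 0"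
    and source: "xdag = power_op (adjoint A \<circ> A) \<mu> \<omega>"
  defines "\<rho> \<equiv> min (2 * \<mu>) (\<mu> + (\<beta> + 1) / 4)"
  obtains C where "C > 0"
    "\<And>k y. k \<ge> 1 \<Longrightarrow> norm (nesterov A (\<lambda>j. (real j - 1) / (real j + \<beta>)) y k - xdag)
       \<le> C * real k powr - \<rho> + sqrt 2 * real k * norm (A xdag - y)"
proof -
  define T where "T = adjoint A \<circ> A"
  interpret positive_contraction T
    unfolding T_def by (rule positive_contraction_normal[OF A])
  interpret T: bounded_linear T by (rule bounded_linear_T)
  interpret adj: bounded_linear "adjoint A" by (rule bounded_linear_adjoint_hilbert[OF A(1)])
  define \<nu> where "\<nu> = (\<beta> + 1) / 2"
  have \<nu>: "\<nu> > 0" "2 * \<nu> - 1 = \<beta>" "\<nu> / 2 = (\<beta> + 1) / 4" unfolding \<nu>_def using pos by (auto simp: field_simps)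
  define \<alpha> where "\<alpha> = (\<lambda>j. (real j - 1) / (real j + \<beta>))"
  have \<alpha>_le: "\<bar>\<alpha> (Suc n)\<bar> \<le> 1" for n
    unfolding \<alpha>_def using pos by auto
  obtain C where C: "C > 0" and rate: "\<And>t k. 0 \<le> t \<Longrightarrow> t \<le> 1 \<Longrightarrow> k \<ge> 1 \<Longrightarrow>
      \<bar>poly (residual_poly \<alpha> k) t\<bar> * t powr \<mu> \<le> C * real k powr - \<rho>"
    using residual_rate[OF \<nu>(1) pos(2)] unfolding \<nu>(2,3) \<alpha>_def \<rho>_def by blast
  show thesis
  proof (rule that)
    show "C * norm \<omega> + 1 > 0" using C by (simp add: add_nonneg_pos)
    fix k y assume k: "(k::nat) \<ge> 1"
    let ?g = "nesterov_poly \<alpha> k" and ?r = "residual_poly \<alpha> k"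
    interpret g: bounded_linear "poly_op ?g T" by (rule bounded_linear_poly)
    have "continuous_on {0..1} (\<lambda>t::real. t powr \<mu>)"
      using pos by (intro continuous_on_powr') (auto intro!: continuous_intros)
    then have "norm (poly_op ?r T xdag) \<le> C * real k powr - \<rho> * norm \<omega>"
      unfolding source power_op_def T_def[symmetric]
      using rate[OF _ _ k] by (intro norm_poly_op_fun_calc_le) (auto simp: abs_mult)
    moreover have "norm (poly_op ?g T (adjoint A (A xdag - y))) \<le> sqrt 2 * real k * norm (A xdag - y)"
      unfolding T_def
    proof (rule norm_poly_op_adjoint_le[OF A])
      fix t :: real assume t: "0 \<le> t" "t \<le> 1"
      have "t * poly ?g t ^ 2 \<le> 2 * real k ^ 2"
      proof (rule nesterov_poly_bound[of \<alpha>])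
        show "\<bar>poly (residual_poly \<alpha> n) t\<bar> \<le> 1" for n
          using abs_residual_le_1[OF \<nu>(1) t] unfolding \<nu>(2) \<alpha>_def .
      qed (use t \<alpha>_le in auto)
      then show "t * poly ?g t ^ 2 \<le> (sqrt 2 * real k) ^ 2"
        by (simp add: power_mult_distrib)
    qed simp
    moreover have "nesterov A \<alpha> y k - xdag = - poly_op ?r T xdag - poly_op ?g T (adjoint A (A xdag - y))"
    proof -
      have "poly_op ?r T xdag = xdag - poly_op ?g T (T xdag)"
        unfolding residual_poly_def mult.commute[of "[:0, 1:]"] poly_op_diff poly_op_mult[OF bounded_linear_T]
        by (simp add: poly_op_pCons[OF T.linear] T.zero)
      moreover have "nesterov A \<alpha> y k = poly_op ?g T (adjoint A y)"
        unfolding T_def by (rule nesterov_eq_poly_op[OF A(1)])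
      moreover have "adjoint A (A xdag - y) = T xdag - adjoint A y"
        by (simp add: adj.diff T_def)
      ultimately show ?thesis by (simp add: g.diff)
    qed
    ultimately have "norm (nesterov A \<alpha> y k - xdag)
        \<le> C * real k powr - \<rho> * norm \<omega> + sqrt 2 * real k * norm (A xdag - y)"
      using norm_triangle_ineq4[of "- poly_op ?r T xdag" "poly_op ?g T (adjoint A (A xdag - y))"] by simp
    also have "C * real k powr - \<rho> * norm \<omega> \<le> (C * norm \<omega> + 1) * real k powr - \<rho>"
      by (simp add: algebra_simps)
    finally show "norm (nesterov A (\<lambda>j. (real j - 1) / (real j + \<beta>)) y k - xdag)
        \<le> (C * norm \<omega> + 1) * real k powr - \<rho> + sqrt 2 * real k * norm (A xdag - y)"
      unfolding \<alpha>_def by simp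
  qed
qed

text \<open>
  With the stopping index of order \<open>\<delta> powr (- 1 / (\<rho> + 1))\<close> the two error terms are of equal size.
\<close>

lemma a_priori_stopping_rate:
  fixes e :: "real \<Rightarrow> real" and k :: "real \<Rightarrow> nat"
  assumes "\<rho> > 0"
    and e: "\<And>\<delta>. \<delta> > 0 \<Longrightarrow> \<bar>e \<delta>\<bar> \<le> C * real (k \<delta>) powr - \<rho> + D * real (k \<delta>) * \<delta>"
    and k: "(\<lambda>\<delta>. real (k \<delta>)) \<in> \<Theta>[at_right 0](\<lambda>\<delta>. \<delta> powr (- (1 / (\<rho> + 1))))"
  shows "e \<in> O[at_right 0](\<lambda>\<delta>. \<delta> powr (\<rho> / (\<rho> + 1)))"
proof -
  have pos: "\<forall>\<^sub>F \<delta> in at_right (0::real). \<delta> > 0"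
    by (simp add: eventually_at_right_less)
  have "(\<lambda>\<delta>. real (k \<delta>) powr - \<rho>) \<in> \<Theta>[at_right 0](\<lambda>\<delta>. (\<delta> powr (- (1 / (\<rho> + 1)))) powr - \<rho>)"
    using bigtheta_powr[OF k, of "- \<rho>"] by simp
  then have 1: "(\<lambda>\<delta>. real (k \<delta>) powr - \<rho>) \<in> O[at_right 0](\<lambda>\<delta>. \<delta> powr (\<rho> / (\<rho> + 1)))"
    by (simp add: powr_powr bigthetaD1)
  have "(\<lambda>\<delta>. real (k \<delta>) * \<delta>) \<in> O[at_right 0](\<lambda>\<delta>. \<delta> powr (- (1 / (\<rho> + 1))) * \<delta>)"
    using k by (intro landau_o.big.mult bigthetaD1) auto
  also have "(\<lambda>\<delta>. \<delta> powr (- (1 / (\<rho> + 1))) * \<delta>) \<in> \<Theta>[at_right 0](\<lambda>\<delta>. \<delta> powr (\<rho> / (\<rho> + 1)))"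
  proof (rule bigthetaI_cong)
    show "\<forall>\<^sub>F \<delta> in at_right 0. \<delta> powr (- (1 / (\<rho> + 1))) * \<delta> = \<delta> powr (\<rho> / (\<rho> + 1))"
      using pos
    proof eventually_elim
      case (elim \<delta>)
      have "\<rho> / (\<rho> + 1) = - (1 / (\<rho> + 1)) + 1" using \<open>\<rho> > 0\<close> by (simp add: field_simps)
      then show ?case using elim by (simp only: powr_add) simp
    qed
  qed
  finally have 2: "(\<lambda>\<delta>. real (k \<delta>) * \<delta>) \<in> O[at_right 0](\<lambda>\<delta>. \<delta> powr (\<rho> / (\<rho> + 1)))" .
  have "(\<lambda>\<delta>. C * real (k \<delta>) powr - \<rho> + D * (real (k \<delta>) * \<delta>)) \<in> O[at_right 0](\<lambda>\<delta>. \<delta> powr (\<rho> / (\<rho> + 1)))"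
    using 1 2 by (intro sum_in_bigo(1)) simp_all
  moreover have "e \<in> O[at_right 0](\<lambda>\<delta>. C * real (k \<delta>) powr - \<rho> + D * (real (k \<delta>) * \<delta>))"
  proof (rule landau_o.bigI[of 1])
    show "\<forall>\<^sub>F \<delta> in at_right 0. norm (e \<delta>) \<le> 1 * norm (C * real (k \<delta>) powr - \<rho> + D * (real (k \<delta>) * \<delta>))"
      using pos
    proof eventually_elim
      case (elim \<delta>)
      then show ?case using e[of \<delta>] by (simp add: mult.assoc)
    qed
  qed simp
  ultimately show ?thesis by (rule landau_o.big_trans[rotated])
qed

theorem theorem4:
  fixes A :: "'a::{real_inner, complete_space} \<Rightarrow> 'b::{real_inner, complete_space}"
    and \<beta> \<mu> :: real and xdag \<omega> :: 'a and y :: 'b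
    and ydelta :: "real \<Rightarrow> 'b" and k :: "real \<Rightarrow> nat"
  assumes "bounded_linear A"
    and "onorm (adjoint A \<circ> A) \<le> 1"
    and "\<beta> > -1"
    and "is_arg_min norm (\<lambda>x. A x = y) xdag"
    and "\<mu> > 0"
    and "xdag = power_op (adjoint A \<circ> A) \<mu> \<omega>"
    and "\<And>\<delta>. \<delta> > 0 \<Longrightarrow> norm (A xdag - ydelta \<delta>) = \<delta>"
    and "\<And>\<delta>. \<delta> > 0 \<Longrightarrow> k \<delta> > 0"
  defines "x \<equiv> (\<lambda>\<delta>. nesterov A (\<lambda>j. (real j - 1) / (real j + \<beta>)) (ydelta \<delta>))"
  shows "(\<mu> \<le> (\<beta> + 1) / 4 \<longrightarrow>
            (\<lambda>\<delta>. real (k \<delta>)) \<in> \<Theta>[at_right 0](\<lambda>\<delta>. \<delta> powr (- (1 / (2 * \<mu> + 1)))) \<longrightarrow>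
            (\<lambda>\<delta>. norm (x \<delta> (k \<delta>) - xdag)) \<in> O[at_right 0](\<lambda>\<delta>. \<delta> powr (2 * \<mu> / (2 * \<mu> + 1))))
       \<and> (\<mu> > (\<beta> + 1) / 4 \<longrightarrow>
            (\<lambda>\<delta>. real (k \<delta>)) \<in> \<Theta>[at_right 0](\<lambda>\<delta>. \<delta> powr (- (1 / (\<mu> + (\<beta> + 1) / 4 + 1)))) \<longrightarrow>
            (\<lambda>\<delta>. norm (x \<delta> (k \<delta>) - xdag)) \<in>
               O[at_right 0](\<lambda>\<delta>. \<delta> powr ((\<mu> + (\<beta> + 1) / 4) / (\<mu> + (\<beta> + 1) / 4 + 1))))"
proof -
  define \<rho> where "\<rho> = min (2 * \<mu>) (\<mu> + (\<beta> + 1) / 4)"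
  have "\<rho> > 0" unfolding \<rho>_def using assms(3,5) by (auto intro!: add_pos_pos)
  obtain C where C: "\<And>k y. k \<ge> 1 \<Longrightarrow> norm (nesterov A (\<lambda>j. (real j - 1) / (real j + \<beta>)) y k - xdag)
       \<le> C * real k powr - \<rho> + sqrt 2 * real k * norm (A xdag - y)"
    using nesterov_error_bound[OF assms(1,2,3,5,6)] unfolding \<rho>_def by blast
  have bound: "\<bar>norm (x \<delta> (k \<delta>) - xdag)\<bar> \<le> C * real (k \<delta>) powr - \<rho> + sqrt 2 * real (k \<delta>) * \<delta>" if "\<delta> > 0" for \<delta>
    using C[of "k \<delta>" "ydelta \<delta>"] assms(7,8)[OF that] unfolding x_def by simp
  have rate: "(\<lambda>\<delta>. norm (x \<delta> (k \<delta>) - xdag)) \<in> O[at_right 0](\<lambda>\<delta>. \<delta> powr (\<rho> / (\<rho> + 1)))"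
    if "(\<lambda>\<delta>. real (k \<delta>)) \<in> \<Theta>[at_right 0](\<lambda>\<delta>. \<delta> powr (- (1 / (\<rho> + 1))))"
    by (rule a_priori_stopping_rate[OF \<open>\<rho> > 0\<close> bound that])
  show ?thesis
  proof (intro conjI impI)
    assume "\<mu> \<le> (\<beta> + 1) / 4"
    then have "\<rho> = 2 * \<mu>" unfolding \<rho>_def by simp
    then show "(\<lambda>\<delta>. norm (x \<delta> (k \<delta>) - xdag)) \<in> O[at_right 0](\<lambda>\<delta>. \<delta> powr (2 * \<mu> / (2 * \<mu> + 1)))"
      if "(\<lambda>\<delta>. real (k \<delta>)) \<in> \<Theta>[at_right 0](\<lambda>\<delta>. \<delta> powr (- (1 / (2 * \<mu> + 1))))"
      using rate that by simp
  next
    assume "\<mu> > (\<beta> + 1) / 4"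
    then have "\<rho> = \<mu> + (\<beta> + 1) / 4" unfolding \<rho>_def by simp
    then show "(\<lambda>\<delta>. norm (x \<delta> (k \<delta>) - xdag)) \<in>
        O[at_right 0](\<lambda>\<delta>. \<delta> powr ((\<mu> + (\<beta> + 1) / 4) / (\<mu> + (\<beta> + 1) / 4 + 1)))"
      if "(\<lambda>\<delta>. real (k \<delta>)) \<in> \<Theta>[at_right 0](\<lambda>\<delta>. \<delta> powr (- (1 / (\<mu> + (\<beta> + 1) / 4 + 1))))"
      using rate that by simp
  qed
qed

end
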